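(* Let $G$ be a discrete group. Let $C_1,\dots,C_{k+1}$ and $C_1',\dots,C_{l+1}'$ be products of commutators of the form $[R,u]^{\pm1}=(RuR^{-1}u^{-1})^{\pm1}$, where $R\in F_G$ is a relator and $u\in F_G$. Let $x_i,y_i,x_i',y_i'\in G$, $v_i,v_i'\in F_G$, $n_i,n_i'\in\mathbb{Z}$, and suppose that the identity $$C_1v_1(s_{x_1}s_{y_1}s_{x_1y_1}^{-1})^{n_1}v_1^{-1}\cdots C_kv_k(s_{x_k}s_{y_k}s_{x_ky_k}^{-1})^{n_k}v_k^{-1}C_{k+1}=C_1'v_1'(s_{x_1'}s_{y_1'}s_{x_1'y_1'}^{-1})^{n_1'}v_1'^{-1}\cdots C_l'v_l'(s_{x_l'}s_{y_l'}s_{x_l'y_l'}^{-1})^{n_l'}v_l'^{-1}C_{l+1}'$$ holds in $F_G$. Let $w_1$ and $w_2$ be the words expressing the left- and right-hand sides obtained by expanding the commutators as described in the context. Then $$(1\otimes_{\mathbb{Z}[G]}d)\big(W(w_1)-W(w_2)\big)=\Big(\sum_{i=1}^k n_i\otimes_{\mathbb{Z}[G]}[x_i|y_i]\Big)-\Big(\sum_{i=1}^l n_i'\otimes_{\mathbb{Z}[G]}[x_i'|y_i']\Big).$$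
   Context: $B_nG$ is the degree $n$ part of the inhomogeneous bar resolution of $G$: the free left $\mathbb{Z}[G]$-module on symbols $[g_1|\cdots|g_n]$, $g_i\in G$, with boundary $d[g_1|\cdots|g_n]=g_1[g_2|\cdots|g_n]+\sum_{i=1}^{n-1}(-1)^i[g_1|\cdots|g_ig_{i+1}|\cdots|g_n]+(-1)^n[g_1|\cdots|g_{n-1}]$. $F_G$ is the free group on symbols $s_x$, $x\in G$, and $\phi\colon F_G\to G$ is the homomorphism with $\phi(s_x)=x$. A relator is an element of $\ker\phi$. Given a word written explicitly in the form $w=u_1(s_{x_1}s_{y_1}s_{x_1y_1}^{-1})^{n_1}u_1^{-1}\cdots u_k(s_{x_k}s_{y_k}s_{x_ky_k}^{-1})^{n_k}u_k^{-1}$ with $x_i,y_i\in G$, $u_i\in F_G$, $n_i\in\mathbb{Z}$, set $W(w)=\sum_{i=1}^kn_i\otimes_{\mathbb{Z}[G]}[\phi(u_i)|x_i|y_i]\in\mathbb{Z}\otimes_{\mathbb{Z}[G]}B_3G$. ($W$ depends on the written expression, not only on the element of $F_G$.) Expansion of commutators: every relator $R$ can be written as a product $R=\prod_{p=1}^{r}(s_{a_p}s_{b_p}s_{a_pb_p}^{-1})^{m_p}$ with $a_p,b_p\in G$, $m_p\in\mathbb{Z}$. For each commutator $[R,u]^{\pm1}$ occurring, fix such an expression of $R$. In $[R,u]=R\cdot(uR^{-1}u^{-1})$ write $R$ by this expression and $uR^{-1}u^{-1}$ as $\prod_{p=r}^{1}u(s_{a_p}s_{b_p}s_{a_pb_p}^{-1})^{-m_p}u^{-1}$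 (reversed order). In $[R,u]^{-1}=(uRu^{-1})\cdot R^{-1}$ proceed likewise: $uRu^{-1}=\prod_{p=1}^{r}u(s_{a_p}s_{b_p}s_{a_pb_p}^{-1})^{m_p}u^{-1}$ and $R^{-1}=\prod_{p=r}^{1}(s_{a_p}s_{b_p}s_{a_pb_p}^{-1})^{-m_p}$. Substituting these expressions into both sides of the identity yields $w_1$ and $w_2$ in the form to which $W$ applies. *)

theory Defs
  imports "HOL-Algebra.Free_Abelian_Groups" "HOL-Algebra.Generated_Groups" "HOL-Algebra.Module"
begin

section \<open>The free group on a set\<close>

text \<open>
  A letter \<open>(x, True)\<close> stands for the free generator \<open>s\<^sub>x\<close> and \<open>(x, False)\<close> for its
  inverse.  The elements of the free group are the reduced words; the product of two of them
  is obtained by prepending the letters of the first to the second, cancelling as one goes.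
\<close>

type_synonym 'a fword = "('a \<times> bool) list"

definition inverse_letters :: "'a \<times> bool \<Rightarrow> 'a \<times> bool \<Rightarrow> bool" where
  "inverse_letters p q \<longleftrightarrow> fst p = fst q \<and> snd p \<noteq> snd q"

definition reduced :: "'a fword \<Rightarrow> bool" where
  "reduced w \<longleftrightarrow> successively (\<lambda>p q. \<not> inverse_letters p q) w"

fun prepend_letter :: "'a \<times> bool \<Rightarrow> 'a fword \<Rightarrow> 'a fword" where
  "prepend_letter p [] = [p]"
| "prepend_letter p (q # w) = (if inverse_letters p q then w else p # q # w)"

definition free_group :: "'a set \<Rightarrow> 'a fword monoid" where
  "free_group S =
    \<lparr>carrier = {w. set w \<subseteq> S \<times> UNIV \<and> reduced w},
     monoid.mult = (\<lambda>v w. foldr prepend_letter v w),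
     monoid.one = []\<rparr>"

definition free_gen :: "'a \<Rightarrow> 'a fword" where
  "free_gen x = [(x, True)]"

lemma reduced_Nil [simp]: "reduced []"
  by (simp add: reduced_def)

lemma reduced_tl: "reduced (q # w) \<Longrightarrow> reduced w"
  by (cases w) (auto simp: reduced_def)

lemma prepend_letter_reduced: "reduced w \<Longrightarrow> reduced (prepend_letter p w)"
  by (cases w) (auto simp: reduced_def successively_Cons)

lemma prepend_letter_set: "set (prepend_letter p w) \<subseteq> insert p (set w)"
  by (cases w) auto

lemma prepend_letter_Cons: "reduced (p # w) \<Longrightarrow> prepend_letter p w = p # w"
  by (cases w) (auto simp: reduced_def)

lemma prepend_letter_cancel:
  assumes "reduced w" "inverse_letters p q"
  shows "prepend_letter p (prepend_letter q w) = w"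
proof (cases w)
  case Nil
  then show ?thesis using assms by simp
next
  case (Cons r w')
  show ?thesis
  proof (cases "inverse_letters q r")
    case True
    then have "r = p"
      using assms(2) by (auto simp: inverse_letters_def prod_eq_iff)
    then show ?thesis
      using True Cons assms(1) prepend_letter_Cons by fastforce
  next
    case False
    then show ?thesis using Cons assms(2) by simp
  qed
qed

lemma foldr_prepend_letter_reduced: "reduced w \<Longrightarrow> reduced (foldr prepend_letter v w)"
  by (induction v) (auto intro: prepend_letter_reduced)

lemma foldr_prepend_letter_set: "set (foldr prepend_letter v w) \<subseteq> set v \<union> set w"
  by (induction v) (use prepend_letter_set in fastforce)+

lemma foldr_prepend_letter_Nil: "reduced w \<Longrightarrow> foldr prepend_letter w [] = w"
proof (induction w)
  case (Cons p w)
  then show ?case using prepend_letter_Cons reduced_tl by fastforce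
qed simp

lemma foldr_prepend_letter_prepend:
  assumes "reduced w"
  shows "foldr prepend_letter (prepend_letter p v) w = prepend_letter p (foldr prepend_letter v w)"
proof (cases v)
  case (Cons q v')
  then show ?thesis
    using prepend_letter_cancel[OF foldr_prepend_letter_reduced[OF assms], of p q v'] by auto
qed simp

lemma foldr_prepend_letter_assoc:
  assumes "reduced w"
  shows "foldr prepend_letter (foldr prepend_letter u v) w
       = foldr prepend_letter u (foldr prepend_letter v w)"
  by (induction u) (auto simp: foldr_prepend_letter_prepend[OF assms])

lemma group_free_group: "group (free_group S)"
proof (rule groupI)
  fix x assume x: "x \<in> carrier (free_group S)"
  let ?i = "\<lambda>w. rev (map (\<lambda>p. (fst p, \<not> snd p)) w)"
  have inv: "foldr prepend_letter (?i v) v = []" if "reduced v" for v :: "'a fword"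
    using that
  proof (induction v)
    case (Cons p v)
    then have "prepend_letter (fst p, \<not> snd p) (p # v) = v"
      by (auto simp: inverse_letters_def)
    moreover have "foldr prepend_letter (?i v) v = []"
      using Cons reduced_tl by blast
    ultimately show ?case by simp
  qed simp
  have "foldr prepend_letter (foldr prepend_letter (?i x) []) x = []"
    using x inv[of x] foldr_prepend_letter_assoc[of x "?i x" "[]"] by (simp add: free_group_def)
  moreover have "set (foldr prepend_letter (?i x) []) \<subseteq> S \<times> UNIV"
    using x foldr_prepend_letter_set[of "?i x" "[]"] by (fastforce simp: free_group_def)
  ultimately show "\<exists>y\<in>carrier (free_group S). y \<otimes>\<^bsub>free_group S\<^esub> x = \<one>\<^bsub>free_group S\<^esub>"
    using foldr_prepend_letter_reduced[of "[]" "?i x"]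
    by (intro bexI[of _ "foldr prepend_letter (?i x) []"]) (auto simp: free_group_def)
qed (use foldr_prepend_letter_set foldr_prepend_letter_reduced in
      \<open>fastforce simp: free_group_def foldr_prepend_letter_assoc\<close>)+

lemma free_gen_closed: "x \<in> S \<Longrightarrow> free_gen x \<in> carrier (free_group S)"
  by (simp add: free_gen_def free_group_def reduced_def)

text \<open>The homomorphism from the free group on \<open>carrier G\<close> to \<open>G\<close> with \<open>s\<^sub>x \<mapsto> x\<close>.\<close>

definition eval_hom :: "('a, 'b) monoid_scheme \<Rightarrow> 'a fword \<Rightarrow> 'a" where
  "eval_hom G w = foldr (\<lambda>(x, b) g. (if b then x else inv\<^bsub>G\<^esub> x) \<otimes>\<^bsub>G\<^esub> g) w \<one>\<^bsub>G\<^esub>"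

lemma eval_hom_free_gen: "group G \<Longrightarrow> x \<in> carrier G \<Longrightarrow> eval_hom G (free_gen x) = x"
  by (simp add: eval_hom_def free_gen_def group.is_monoid)

lemma eval_hom_hom:
  fixes G (structure)
  assumes "group G"
  shows "eval_hom G \<in> hom (free_group (carrier G)) G"
proof -
  interpret group G by fact
  have closed: "eval_hom G w \<in> carrier G" if "set w \<subseteq> carrier G \<times> UNIV" for w
    using that by (induction w) (auto simp: eval_hom_def)
  have prep: "eval_hom G (prepend_letter p w) = eval_hom G (p # w)"
    if "set (p # w) \<subseteq> carrier G \<times> UNIV" for p w
  proof (cases w)
    case (Cons q v)
    have "eval_hom G v \<in> carrier G" using closed that Cons by auto
    then show ?thesis
      using that Cons
      by (cases p; cases q)
        (auto simp: eval_hom_def inverse_letters_def m_assoc[symmetric])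
  qed simp
  have "eval_hom G (foldr prepend_letter v w) = eval_hom G v \<otimes> eval_hom G w"
    if "set v \<subseteq> carrier G \<times> UNIV" "set w \<subseteq> carrier G \<times> UNIV" for v w
    using that
  proof (induction v)
    case Nil
    then show ?case using closed by (simp add: eval_hom_def)
  next
    case (Cons p v)
    have "set (p # foldr prepend_letter v w) \<subseteq> carrier G \<times> UNIV"
      using Cons.prems foldr_prepend_letter_set[of v w] by auto
    from prep[OF this] show ?case
      using Cons closed[of v] closed[of w]
      by (cases p) (auto simp: eval_hom_def m_assoc)
  qed
  then show ?thesis
    using closed by (auto simp: hom_def free_group_def)
qed

abbreviation free_group_on :: "('a, 'b) monoid_scheme \<Rightarrow> 'a fword monoid" where
  "free_group_on G \<equiv> free_group (carrier G)"

definition relators :: "('a, 'b) monoid_scheme \<Rightarrow> 'a fword set" where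
  "relators G = kernel (free_group_on G) G (eval_hom G)"


section \<open>The integral group ring and the bar resolution\<close>

type_synonym 'a group_ring_elt = "'a \<Rightarrow>\<^sub>0 int"

definition group_ring :: "('a, 'b) monoid_scheme \<Rightarrow> 'a group_ring_elt ring" where
  "group_ring G =
    \<lparr>carrier = {r. Poly_Mapping.keys r \<subseteq> carrier G},
     monoid.mult = (\<lambda>r s. frag_extend (\<lambda>g. frag_extend (\<lambda>h. frag_of (g \<otimes>\<^bsub>G\<^esub> h)) s) r),
     monoid.one = frag_of \<one>\<^bsub>G\<^esub>,
     ring.zero = 0,
     ring.add = (+)\<rparr>"

definition augmentation :: "'a group_ring_elt \<Rightarrow> int" where
  "augmentation r = (\<Sum>g\<in>Poly_Mapping.keys r. Poly_Mapping.lookup r g)"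

text \<open>
  The ground ring of the library locale \<open>module\<close> is commutative, so for \<open>\<int>[G]\<close>-modules only
  its record type is used.  Its ring fields \<open>mult\<close> and \<open>one\<close> play no role for a module and are
  filled arbitrarily.
\<close>

type_synonym 'a bar_chain = "'a list \<Rightarrow>\<^sub>0 'a group_ring_elt"

text \<open>The free left \<open>\<int>[G]\<close>-module on the symbols \<open>[g\<^sub>1|\<dots>|g\<^sub>n]\<close>, encoded as lists of length \<open>n\<close>.\<close>

definition bar_module ::
  "('a, 'b) monoid_scheme \<Rightarrow> nat \<Rightarrow> ('a group_ring_elt, 'a bar_chain) module" where
  "bar_module G n =
    \<lparr>carrier = {c. (\<forall>gs\<in>Poly_Mapping.keys c. length gs = n \<and> set gs \<subseteq> carrier G) \<and>
                   (\<forall>gs. Poly_Mapping.lookup c gs \<in> carrier (group_ring G))},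
     monoid.mult = undefined,
     monoid.one = undefined,
     ring.zero = 0,
     ring.add = (+),
     smult = (\<lambda>r. Poly_Mapping.map (\<lambda>s. r \<otimes>\<^bsub>group_ring G\<^esub> s))\<rparr>"

definition bar_sym :: "('a, 'b) monoid_scheme \<Rightarrow> 'a list \<Rightarrow> 'a bar_chain" where
  "bar_sym G gs = Poly_Mapping.single gs \<one>\<^bsub>group_ring G\<^esub>"

text \<open>
  The boundary of a symbol of degree \<open>n \<ge> 1\<close>.  As list positions start at \<open>0\<close>, the product
  \<open>g\<^sub>i g\<^sub>i\<^sub>+\<^sub>1\<close> is \<open>gs ! (i - 1) \<otimes> gs ! i\<close>.
\<close>

definition bar_boundary_sym :: "('a, 'b) monoid_scheme \<Rightarrow> 'a list \<Rightarrow> 'a bar_chain" where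
  "bar_boundary_sym G gs =
    (if gs = [] then 0 else
      Poly_Mapping.single (tl gs) (frag_of (hd gs))
      + (\<Sum>i = 1..<length gs.
          Poly_Mapping.single
            (take (i - 1) gs @ (gs ! (i - 1) \<otimes>\<^bsub>G\<^esub> gs ! i) # drop (i + 1) gs)
            (frag_cmul ((- 1) ^ i) \<one>\<^bsub>group_ring G\<^esub>))
      + Poly_Mapping.single (butlast gs) (frag_cmul ((- 1) ^ length gs) \<one>\<^bsub>group_ring G\<^esub>))"

text \<open>Its \<open>\<int>[G]\<close>-linear extension; the scalar multiplication does not depend on the degree.\<close>

definition bar_boundary :: "('a, 'b) monoid_scheme \<Rightarrow> nat \<Rightarrow> 'a bar_chain \<Rightarrow> 'a bar_chain" where
  "bar_boundary G n c =
    (\<Sum>gs\<in>Poly_Mapping.keys c.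
      Poly_Mapping.lookup c gs \<odot>\<^bsub>bar_module G (n - 1)\<^esub> bar_boundary_sym G gs)"


section \<open>Tensor products over a possibly noncommutative ring\<close>

text \<open>
  In \<open>A \<otimes>\<^sub>R M\<close> the first factor is a right module: for it, \<open>r \<odot>\<^bsub>A\<^esub> a\<close> is read as \<open>a \<cdot> r\<close>.
  The tensor product is the quotient of the free abelian group on \<open>A \<times> M\<close> by the subgroup
  generated by the usual relations.
\<close>

definition tensor_relations ::
  "('r, 'k) ring_scheme \<Rightarrow> ('r, 'a) module \<Rightarrow> ('r, 'm) module \<Rightarrow> ('a \<times> 'm \<Rightarrow>\<^sub>0 int) set" where
  "tensor_relations R A M =
     {frag_of (a \<oplus>\<^bsub>A\<^esub> a', m) - frag_of (a, m) - frag_of (a', m) | a a' m.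
        a \<in> carrier A \<and> a' \<in> carrier A \<and> m \<in> carrier M}
   \<union> {frag_of (a, m \<oplus>\<^bsub>M\<^esub> m') - frag_of (a, m) - frag_of (a, m') | a m m'.
        a \<in> carrier A \<and> m \<in> carrier M \<and> m' \<in> carrier M}
   \<union> {frag_of (r \<odot>\<^bsub>A\<^esub> a, m) - frag_of (a, r \<odot>\<^bsub>M\<^esub> m) | r a m.
        r \<in> carrier R \<and> a \<in> carrier A \<and> m \<in> carrier M}"

definition tensor_kernel ::
  "('r, 'k) ring_scheme \<Rightarrow> ('r, 'a) module \<Rightarrow> ('r, 'm) module \<Rightarrow> ('a \<times> 'm \<Rightarrow>\<^sub>0 int) set" where
  "tensor_kernel R A M =
     generate (free_Abelian_group (carrier A \<times> carrier M)) (tensor_relations R A M)"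

definition tensor_class ::
  "('r, 'k) ring_scheme \<Rightarrow> ('r, 'a) module \<Rightarrow> ('r, 'm) module
    \<Rightarrow> ('a \<times> 'm \<Rightarrow>\<^sub>0 int) \<Rightarrow> ('a \<times> 'm \<Rightarrow>\<^sub>0 int) set" where
  "tensor_class R A M z =
     tensor_kernel R A M #>\<^bsub>free_Abelian_group (carrier A \<times> carrier M)\<^esub> z"

text \<open>
  The quotient group of the library is written multiplicatively; here its operation becomes
  the addition of a ring record whose multiplicative fields are irrelevant.
\<close>

definition tensor_product ::
  "('r, 'k) ring_scheme \<Rightarrow> ('r, 'a) module \<Rightarrow> ('r, 'm) module
    \<Rightarrow> ('a \<times> 'm \<Rightarrow>\<^sub>0 int) set ring" where
  "tensor_product R A M =
    (let Q = free_Abelian_group (carrier A \<times> carrier M) Mod tensor_kernel R A M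
     in \<lparr>carrier = carrier Q,
         monoid.mult = undefined,
         monoid.one = undefined,
         ring.zero = \<one>\<^bsub>Q\<^esub>,
         ring.add = monoid.mult Q\<rparr>)"

definition tensor ::
  "('r, 'k) ring_scheme \<Rightarrow> ('r, 'a) module \<Rightarrow> ('r, 'm) module
    \<Rightarrow> 'a \<Rightarrow> 'm \<Rightarrow> ('a \<times> 'm \<Rightarrow>\<^sub>0 int) set" where
  "tensor R A M a m = tensor_class R A M (frag_of (a, m))"

text \<open>
  The map \<open>1 \<otimes> f : A \<otimes>\<^sub>R M \<rightarrow> A \<otimes>\<^sub>R N\<close> induced by \<open>f : M \<rightarrow> N\<close>: a class \<open>c\<close> is sent to the
  common class of the images of its representatives.
\<close>

definition tensor_map ::
  "('r, 'k) ring_scheme \<Rightarrow> ('r, 'a) module \<Rightarrow> ('r, 'n) module \<Rightarrow> ('m \<Rightarrow> 'n)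
    \<Rightarrow> ('a \<times> 'm \<Rightarrow>\<^sub>0 int) set \<Rightarrow> ('a \<times> 'n \<Rightarrow>\<^sub>0 int) set" where
  "tensor_map R A N f c =
     the_elem ((\<lambda>z. tensor_class R A N (frag_extend (\<lambda>(a, m). frag_of (a, f m)) z)) ` c)"

text \<open>The trivial right \<open>\<int>[G]\<close>-module \<open>\<int>\<close>, on which every group element acts as the identity.\<close>

definition trivial_module :: "('a group_ring_elt, int) module" where
  "trivial_module =
    \<lparr>carrier = UNIV, monoid.mult = (*), monoid.one = 1, ring.zero = 0, ring.add = (+),
     smult = (\<lambda>r a. a * augmentation r)\<rparr>"

definition coinv_bar ::
  "('a, 'b) monoid_scheme \<Rightarrow> nat \<Rightarrow> (int \<times> 'a bar_chain \<Rightarrow>\<^sub>0 int) set ring" where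
  "coinv_bar G n = tensor_product (group_ring G) trivial_module (bar_module G n)"

text \<open>The element \<open>n \<otimes> [g\<^sub>1|\<dots>|g\<^sub>q]\<close>, with \<open>q\<close> the length of the list.\<close>

definition coinv_sym ::
  "('a, 'b) monoid_scheme \<Rightarrow> int \<Rightarrow> 'a list \<Rightarrow> (int \<times> 'a bar_chain \<Rightarrow>\<^sub>0 int) set" where
  "coinv_sym G n gs =
     tensor (group_ring G) trivial_module (bar_module G (length gs)) n (bar_sym G gs)"

text \<open>\<open>1 \<otimes> d\<close> from degree \<open>n\<close> to degree \<open>n - 1\<close>.\<close>

definition coinv_boundary ::
  "('a, 'b) monoid_scheme \<Rightarrow> nat \<Rightarrow> (int \<times> 'a bar_chain \<Rightarrow>\<^sub>0 int) set
    \<Rightarrow> (int \<times> 'a bar_chain \<Rightarrow>\<^sub>0 int) set" where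
  "coinv_boundary G n =
     tensor_map (group_ring G) trivial_module (bar_module G (n - 1)) (bar_boundary G n)"


section \<open>Words written as products of conjugates of basic relators\<close>

definition ordered_prod :: "('c, 'd) monoid_scheme \<Rightarrow> 'c list \<Rightarrow> 'c" where
  "ordered_prod F xs = foldr (\<lambda>x y. x \<otimes>\<^bsub>F\<^esub> y) xs \<one>\<^bsub>F\<^esub>"

definition basic_relator :: "('a, 'b) monoid_scheme \<Rightarrow> 'a \<Rightarrow> 'a \<Rightarrow> 'a fword" where
  "basic_relator G x y =
     free_gen x \<otimes>\<^bsub>free_group_on G\<^esub> free_gen y
       \<otimes>\<^bsub>free_group_on G\<^esub> inv\<^bsub>free_group_on G\<^esub> (free_gen (x \<otimes>\<^bsub>G\<^esub> y))"

text \<open>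
  The quadruple \<open>(u, x, y, n)\<close> represents the written factor
  \<open>u (s\<^sub>x s\<^sub>y s\<^sub>x\<^sub>y\<^sup>-\<^sup>1)\<^sup>n u\<^sup>-\<^sup>1\<close>, and a list of quadruples a written product of such factors.
\<close>

type_synonym 'a factor = "'a fword \<times> 'a \<times> 'a \<times> int"

definition factor_value :: "('a, 'b) monoid_scheme \<Rightarrow> 'a factor \<Rightarrow> 'a fword" where
  "factor_value G = (\<lambda>(u, x, y, n).
     u \<otimes>\<^bsub>free_group_on G\<^esub> (basic_relator G x y [^]\<^bsub>free_group_on G\<^esub> n)
       \<otimes>\<^bsub>free_group_on G\<^esub> inv\<^bsub>free_group_on G\<^esub> u)"

definition W :: "('a, 'b) monoid_scheme \<Rightarrow> 'a factor list
    \<Rightarrow> (int \<times> 'a bar_chain \<Rightarrow>\<^sub>0 int) set" where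
  "W G w = (\<Oplus>\<^bsub>coinv_bar G 3\<^esub>i\<in>{..<length w}.
     (case w ! i of (u, x, y, n) \<Rightarrow> coinv_sym G n [eval_hom G u, x, y]))"

text \<open>
  The triple \<open>(R, u, e)\<close> represents \<open>[R, u]\<close> if \<open>e\<close> is true and \<open>[R, u]\<^sup>-\<^sup>1\<close> otherwise.
\<close>

type_synonym 'a commutator = "'a fword \<times> 'a fword \<times> bool"

definition commutator_ok :: "('a, 'b) monoid_scheme \<Rightarrow> 'a commutator \<Rightarrow> bool" where
  "commutator_ok G = (\<lambda>(R, u, e). R \<in> relators G \<and> u \<in> carrier (free_group_on G))"

definition commutator_value :: "('a, 'b) monoid_scheme \<Rightarrow> 'a commutator \<Rightarrow> 'a fword" where
  "commutator_value G = (\<lambda>(R, u, e).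
     let F = free_group_on G;
         c = R \<otimes>\<^bsub>F\<^esub> u \<otimes>\<^bsub>F\<^esub> inv\<^bsub>F\<^esub> R \<otimes>\<^bsub>F\<^esub> inv\<^bsub>F\<^esub> u
     in if e then c else inv\<^bsub>F\<^esub> c)"

definition commutators_value :: "('a, 'b) monoid_scheme \<Rightarrow> 'a commutator list \<Rightarrow> 'a fword" where
  "commutators_value G cs = ordered_prod (free_group_on G) (map (commutator_value G) cs)"

text \<open>
  The triple \<open>(a, b, m)\<close> represents the written factor \<open>(s\<^sub>a s\<^sub>b s\<^sub>a\<^sub>b\<^sup>-\<^sup>1)\<^sup>m\<close>.
\<close>

type_synonym 'a relator_expr = "('a \<times> 'a \<times> int) list"

definition is_expr_of :: "('a, 'b) monoid_scheme \<Rightarrow> 'a relator_expr \<Rightarrow> 'a fword \<Rightarrow> bool" where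
  "is_expr_of G E R \<longleftrightarrow>
     (\<forall>(a, b, m)\<in>set E. a \<in> carrier G \<and> b \<in> carrier G) \<and>
     R = ordered_prod (free_group_on G)
           (map (\<lambda>(a, b, m). basic_relator G a b [^]\<^bsub>free_group_on G\<^esub> m) E)"

text \<open>\<open>u R u\<^sup>-\<^sup>1\<close> and \<open>u R\<^sup>-\<^sup>1 u\<^sup>-\<^sup>1\<close>, written out using an expression of \<open>R\<close>.\<close>

definition conj_expr :: "'a fword \<Rightarrow> 'a relator_expr \<Rightarrow> 'a factor list" where
  "conj_expr u E = map (\<lambda>(a, b, m). (u, a, b, m)) E"

definition conj_inv_expr :: "'a fword \<Rightarrow> 'a relator_expr \<Rightarrow> 'a factor list" where
  "conj_inv_expr u E = map (\<lambda>(a, b, m). (u, a, b, - m)) (rev E)"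

definition expand_commutator ::
  "('a, 'b) monoid_scheme \<Rightarrow> 'a commutator \<Rightarrow> 'a relator_expr \<Rightarrow> 'a factor list" where
  "expand_commutator G = (\<lambda>(R, u, e) E.
     let i = \<one>\<^bsub>free_group_on G\<^esub>
     in if e then conj_expr i E @ conj_inv_expr u E
        else conj_expr u E @ conj_inv_expr i E)"

text \<open>The \<open>j\<close>-th list in \<open>Es\<close> is the expression fixed for the relator of the \<open>j\<close>-th commutator.\<close>

definition expressions_of ::
  "('a, 'b) monoid_scheme \<Rightarrow> 'a relator_expr list \<Rightarrow> 'a commutator list \<Rightarrow> bool" where
  "expressions_of G Es cs \<longleftrightarrow> list_all2 (\<lambda>E (R, u, e). is_expr_of G E R) Es cs"

definition expand_commutators ::
  "('a, 'b) monoid_scheme \<Rightarrow> 'a commutator list \<Rightarrow> 'a relator_expr list \<Rightarrow> 'a factor list" where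
  "expand_commutators G cs Es = concat (map2 (expand_commutator G) cs Es)"

text \<open>
  One side of the identity,
  \<open>C\<^sub>1 v\<^sub>1 (\<dots>)\<^sup>n\<^sub>1 v\<^sub>1\<^sup>-\<^sup>1 \<dots> C\<^sub>k v\<^sub>k (\<dots>)\<^sup>n\<^sub>k v\<^sub>k\<^sup>-\<^sup>1 C\<^sub>k\<^sub>+\<^sub>1\<close>,
  first as an element of the free group and then as a written product, with the commutators
  of \<open>C\<^sub>i\<close> expanded by means of the expressions \<open>E i\<close>.
\<close>

definition side_value ::
  "('a, 'b) monoid_scheme \<Rightarrow> nat \<Rightarrow> (nat \<Rightarrow> 'a commutator list) \<Rightarrow> (nat \<Rightarrow> 'a fword)
    \<Rightarrow> (nat \<Rightarrow> 'a) \<Rightarrow> (nat \<Rightarrow> 'a) \<Rightarrow> (nat \<Rightarrow> int) \<Rightarrow> 'a fword" where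
  "side_value G k C v x y n =
     ordered_prod (free_group_on G)
       (map (\<lambda>i. commutators_value G (C i)
                   \<otimes>\<^bsub>free_group_on G\<^esub> factor_value G (v i, x i, y i, n i)) [1..<k + 1])
     \<otimes>\<^bsub>free_group_on G\<^esub> commutators_value G (C (k + 1))"

definition side_word ::
  "('a, 'b) monoid_scheme \<Rightarrow> nat \<Rightarrow> (nat \<Rightarrow> 'a commutator list)
    \<Rightarrow> (nat \<Rightarrow> 'a relator_expr list) \<Rightarrow> (nat \<Rightarrow> 'a fword)
    \<Rightarrow> (nat \<Rightarrow> 'a) \<Rightarrow> (nat \<Rightarrow> 'a) \<Rightarrow> (nat \<Rightarrow> int) \<Rightarrow> 'a factor list" where
  "side_word G k C E v x y n =
     concat (map (\<lambda>i. expand_commutators G (C i) (E i) @ [(v i, x i, y i, n i)]) [1..<k + 1])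
     @ expand_commutators G (C (k + 1)) (E (k + 1))"

end

theory Submission
  imports Defs
begin

text \<open>
  A word in the letters \<open>s\<^sub>x\<^sup>\<plusminus>\<^sup>1\<close> spells a path in the Cayley graph of \<open>G\<close>.  Summing
  \<open>[h|x]\<close> over its edges \<open>h \<rightarrow> hx\<close>, with sign according to the direction of travel, gives a map
  (\<open>path_sum\<close>) on the free group that is additive on concatenated paths.  The loop spelled by
  \<open>u (s\<^sub>x s\<^sub>y s\<^sub>x\<^sub>y\<^sup>-\<^sup>1)\<^sup>n u\<^sup>-\<^sup>1\<close> contributes \<open>n ([g|x] + [gx|y] - [g|xy])\<close>, where
  \<open>g = \<phi>(u)\<close>, and this is \<open>n [x|y]\<close> minus the image of \<open>n [g|x|y]\<close> under \<open>1 \<otimes> d\<close>.  So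
  \<open>(1 \<otimes> d) W(w)\<close> is \<open>\<Sum> n\<^sub>i [x\<^sub>i|y\<^sub>i]\<close>, over all factors of \<open>w\<close>, minus a term
  depending only on the element of the free group expressed by \<open>w\<close>.  The factors coming from a
  commutator cancel in that sum.
\<close>

section \<open>Tensor products\<close>

text \<open>The four closure conditions put every defining relation of the tensor product inside the
  free abelian group on \<open>carrier A \<times> carrier M\<close>, so that the relations generate
  a subgroup of it.\<close>

locale tensor_factors =
  fixes R :: "('r, 'k) ring_scheme" and A :: "('r, 'a) module" and M :: "('r, 'm) module"
  assumes left_add_closed: "\<lbrakk>a \<in> carrier A; a' \<in> carrier A\<rbrakk> \<Longrightarrow> a \<oplus>\<^bsub>A\<^esub> a' \<in> carrier A"
    and right_add_closed: "\<lbrakk>m \<in> carrier M; m' \<in> carrier M\<rbrakk> \<Longrightarrow> m \<oplus>\<^bsub>M\<^esub> m' \<in> carrier M"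
    and left_smult_closed: "\<lbrakk>r \<in> carrier R; a \<in> carrier A\<rbrakk> \<Longrightarrow> r \<odot>\<^bsub>A\<^esub> a \<in> carrier A"
    and right_smult_closed: "\<lbrakk>r \<in> carrier R; m \<in> carrier M\<rbrakk> \<Longrightarrow> r \<odot>\<^bsub>M\<^esub> m \<in> carrier M"
begin

abbreviation "frags \<equiv> free_Abelian_group (carrier A \<times> carrier M)"
abbreviation "ker \<equiv> tensor_kernel R A M"
abbreviation "cls \<equiv> tensor_class R A M"
abbreviation "tens \<equiv> tensor_product R A M"

lemma tensor_relations_subset: "tensor_relations R A M \<subseteq> carrier frags"
proof -
  have [simp]: "a + b \<in> carrier frags" "a - b \<in> carrier frags"
    if "a \<in> carrier frags" "b \<in> carrier frags" for a b
    using that keys_add[of a b] keys_diff[of a b] by fastforce+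
  show ?thesis
    unfolding tensor_relations_def
    by (auto simp del: carrier_free_Abelian_group_iff
        simp: left_add_closed right_add_closed left_smult_closed right_smult_closed)
qed

lemma subgroup_tensor_kernel: "subgroup ker frags"
  unfolding tensor_kernel_def
  by (rule group.generate_is_subgroup[OF group_free_Abelian_group tensor_relations_subset])

lemma normal_tensor_kernel: "ker \<lhd> frags"
  using comm_group.normal_iff_subgroup[OF abelian_free_Abelian_group] subgroup_tensor_kernel
  by blast

lemma tensor_kernel_keys: "z \<in> ker \<Longrightarrow> Poly_Mapping.keys z \<subseteq> carrier A \<times> carrier M"
  using subsetD[OF subgroup.subset[OF subgroup_tensor_kernel]] carrier_free_Abelian_group_iff by metis

lemma tensor_kernel_zero: "0 \<in> ker"
  using subgroup.one_closed[OF subgroup_tensor_kernel] by simp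

lemma tensor_kernel_add: "\<lbrakk>z \<in> ker; z' \<in> ker\<rbrakk> \<Longrightarrow> z + z' \<in> ker"
  using subgroup.m_closed[OF subgroup_tensor_kernel] by simp

lemma tensor_kernel_uminus: "z \<in> ker \<Longrightarrow> - z \<in> ker"
  using subgroup.m_inv_closed[OF subgroup_tensor_kernel] tensor_kernel_keys by fastforce

lemma tensor_kernel_diff: "\<lbrakk>z \<in> ker; z' \<in> ker\<rbrakk> \<Longrightarrow> z - z' \<in> ker"
  using tensor_kernel_add[OF _ tensor_kernel_uminus, of z z'] by simp

lemma tensor_kernel_sum: "(\<And>i. i \<in> I \<Longrightarrow> f i \<in> ker) \<Longrightarrow> sum f I \<in> ker"
  by (induction I rule: infinite_finite_induct) (auto simp: tensor_kernel_zero tensor_kernel_add)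

lemma tensor_kernel_relation: "z \<in> tensor_relations R A M \<Longrightarrow> z \<in> ker"
  unfolding tensor_kernel_def by (rule generate.incl)

lemma tensor_class_alt: "cls z = (\<lambda>h. h + z) ` ker"
  by (auto simp: tensor_class_def r_coset_def)

text \<open>Equations between tensors are reduced by this rule to membership of a difference in
  \<open>ker\<close>, where kernel elements can be added and subtracted freely.\<close>

lemma tensor_class_eqI:
  assumes "z - z' \<in> ker"
  shows "cls z = cls z'"
proof -
  \<comment> \<open>Both inclusions of cosets: a translate by \<open>h\<close> is corrected by the
    kernel element \<open>z - z'\<close>.\<close>
  have "h + z = (h + (z - z')) + z'" "h + z' = (h - (z - z')) + z" for h
    by simp_all
  with assms show ?thesis
    unfolding tensor_class_alt image_def
    by (blast intro: tensor_kernel_add tensor_kernel_diff)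
qed

text \<open>The additive part of the record is the quotient group itself, which inherits
  commutativity from the free abelian group.\<close>

lemma abelian_group_tensor_product: "abelian_group tens"
proof -
  have "comm_group (frags Mod ker)"
    by (rule comm_group.abelian_FactGroup[OF abelian_free_Abelian_group subgroup_tensor_kernel])
  moreover have "add_monoid tens = frags Mod ker"
    by (simp add: tensor_product_def Let_def)
  ultimately have "comm_group (add_monoid tens)"
    by simp
  then show ?thesis
    by (simp add: abelian_group_def abelian_group_axioms_def abelian_monoid_def comm_group_def)
qed

sublocale tens: abelian_group tens
  by (rule abelian_group_tensor_product)

lemma tensor_class_closed: "z \<in> carrier frags \<Longrightarrow> cls z \<in> carrier tens"
  by (auto simp: tensor_class_def tensor_product_def Let_def FactGroup_def RCOSETS_def)

lemma tensor_class_add: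
  "\<lbrakk>z \<in> carrier frags; z' \<in> carrier frags\<rbrakk> \<Longrightarrow> cls z \<oplus>\<^bsub>tens\<^esub> cls z' = cls (z + z')"
  using normal.rcos_sum[OF normal_tensor_kernel, of z z']
  by (simp add: tensor_class_def tensor_product_def Let_def FactGroup_def)

lemma tensor_class_zero: "cls 0 = \<zero>\<^bsub>tens\<^esub>"
  by (auto simp: tensor_class_alt tensor_product_def Let_def FactGroup_def)

lemma tensor_class_diff:
  assumes "z \<in> carrier frags" "z' \<in> carrier frags"
  shows "cls z \<ominus>\<^bsub>tens\<^esub> cls z' = cls (z - z')"
proof -
  have m: "- z' \<in> carrier frags" using assms by simp
  have "\<ominus>\<^bsub>tens\<^esub> cls z' = cls (- z')"
    by (rule tens.minus_equality)
      (use assms m in \<open>auto simp: tensor_class_closed tensor_class_add tensor_class_zero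
        simp del: carrier_free_Abelian_group_iff\<close>)
  then show ?thesis
    using assms m by (simp add: a_minus_def tensor_class_add del: carrier_free_Abelian_group_iff)
qed

lemma frags_sum_closed: "(\<And>i. i \<in> I \<Longrightarrow> f i \<in> carrier frags) \<Longrightarrow> sum f I \<in> carrier frags"
  using keys_sum[of f I] by fastforce

lemma tensor_class_finsum:
  assumes "finite I" "\<And>i. i \<in> I \<Longrightarrow> f i \<in> carrier frags"
  shows "(\<Oplus>\<^bsub>tens\<^esub>i\<in>I. cls (f i)) = cls (sum f I)"
  using assms
proof (induction I)
  case (insert i I)
  then show ?case
    by (simp add: tens.finsum_insert tensor_class_closed Pi_def frags_sum_closed tensor_class_add
        del: carrier_free_Abelian_group_iff)
qed (simp add: tensor_class_zero)

lemma frag_of_add_left: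
  "\<lbrakk>a \<in> carrier A; a' \<in> carrier A; m \<in> carrier M\<rbrakk>
    \<Longrightarrow> frag_of (a \<oplus>\<^bsub>A\<^esub> a', m) - frag_of (a, m) - frag_of (a', m) \<in> ker"
  by (rule tensor_kernel_relation) (auto simp: tensor_relations_def)

lemma frag_of_add_right:
  "\<lbrakk>a \<in> carrier A; m \<in> carrier M; m' \<in> carrier M\<rbrakk>
    \<Longrightarrow> frag_of (a, m \<oplus>\<^bsub>M\<^esub> m') - frag_of (a, m) - frag_of (a, m') \<in> ker"
  by (rule tensor_kernel_relation) (auto simp: tensor_relations_def)

lemma frag_of_smult:
  "\<lbrakk>r \<in> carrier R; a \<in> carrier A; m \<in> carrier M\<rbrakk>
    \<Longrightarrow> frag_of (r \<odot>\<^bsub>A\<^esub> a, m) - frag_of (a, r \<odot>\<^bsub>M\<^esub> m) \<in> ker"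
  by (rule tensor_kernel_relation) (auto simp: tensor_relations_def)

end

lemma frag_extend_diff_of:
  "frag_extend f (frag_of p - frag_of q - frag_of r) = f p - f q - f r"
  "frag_extend f (frag_of p - frag_of q) = f p - f q"
  by (simp_all add: frag_extend_diff)

text \<open>The \<open>the_elem\<close> in \<open>tensor_map\<close> is justified because the image
  of a coset is a singleton: an additive and \<open>R\<close>-linear \<open>f\<close> sends each
  defining relation to one of the same type, hence kernel to kernel, and all representatives yield
  the same class.\<close>

lemma tensor_map_class:
  assumes "tensor_factors R A M" "tensor_factors R A N"
    and closed: "\<And>m. m \<in> carrier M \<Longrightarrow> f m \<in> carrier N"
    and add: "\<And>m m'. \<lbrakk>m \<in> carrier M; m' \<in> carrier M\<rbrakk> \<Longrightarrow> f (m \<oplus>\<^bsub>M\<^esub> m') = f m \<oplus>\<^bsub>N\<^esub> f m'"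
    and smult: "\<And>r m. \<lbrakk>r \<in> carrier R; m \<in> carrier M\<rbrakk> \<Longrightarrow> f (r \<odot>\<^bsub>M\<^esub> m) = r \<odot>\<^bsub>N\<^esub> f m"
  shows "tensor_map R A N f (tensor_class R A M z)
    = tensor_class R A N (frag_extend (\<lambda>(a, m). frag_of (a, f m)) z)"
proof -
  interpret M: tensor_factors R A M by fact
  interpret N: tensor_factors R A N by fact
  let ?F = "frag_extend (\<lambda>(a, m). frag_of (a, f m))"
  have rel: "?F h \<in> N.ker" if "h \<in> tensor_relations R A M" for h
    using that unfolding tensor_relations_def
    by (auto simp: frag_extend_diff_of add smult closed
        intro!: N.frag_of_add_left N.frag_of_add_right N.frag_of_smult)
  have ker: "?F h \<in> N.ker" if "h \<in> M.ker" for h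
    using that unfolding tensor_kernel_def[of R A M]
  proof (induction rule: generate.induct)
    case (inv h)
    \<comment> \<open>The group inverse rewrites to negation for elements of the carrier, so
      membership of the generator comes first.\<close>
    then have "h \<in> carrier M.frags" using M.tensor_relations_subset by blast
    then show ?case using rel[OF inv] by (simp add: frag_extend_minus N.tensor_kernel_uminus)
  qed (auto simp: rel N.tensor_kernel_zero frag_extend_add N.tensor_kernel_add)
  have "N.cls (?F (h + z)) = N.cls (?F z)" if "h \<in> M.ker" for h
    by (rule N.tensor_class_eqI) (use ker[OF that] in \<open>simp add: frag_extend_add\<close>)
  then have "(\<lambda>z. N.cls (?F z)) ` M.cls z = {N.cls (?F z)}"
    using M.tensor_kernel_zero unfolding M.tensor_class_alt by (auto simp: image_iff)
  then show ?thesis by (simp add: tensor_map_def)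
qed

text \<open>
  A locale of its own, since the tensor products and the free group are groups again and
  sublocale declarations for \<open>group\<close> would not terminate.
\<close>

locale bar_group = group G for G (structure)

section \<open>The bar resolution\<close>

text \<open>This yields distributivity of the group ring product in its second factor, which sits
  inside the function being extended.\<close>

lemma frag_extend_distrib:
  "frag_extend (\<lambda>x. f x + g x) c = frag_extend f c + frag_extend g c"
  by (simp add: frag_extend_def frag_cmul_distrib2 sum.distrib)

lemma frag_cmul_minus_right: "frag_cmul k (a - b) = frag_cmul k a - frag_cmul k b"
  by (rule poly_mapping_eqI) (simp add: lookup_minus right_diff_distrib)

lemma augmentation_simps [simp]:
  "augmentation (frag_of g) = 1"
  "augmentation (frag_cmul k (frag_of g)) = k"
proof -
  \<comment> \<open>For \<open>k = 0\<close> the support is empty, and the empty sum still equals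
    \<open>k\<close>.\<close>
  have "Poly_Mapping.keys (frag_cmul k (frag_of g)) = (if k = 0 then {} else {g})" for k
    by auto
  then show k: "augmentation (frag_cmul k (frag_of g)) = k" for k
    by (simp add: augmentation_def)
  show "augmentation (frag_of g) = 1"
    using k[of 1] by simp
qed

lemma trivial_module_simps [simp]:
  "carrier trivial_module = UNIV"
  "a \<oplus>\<^bsub>trivial_module\<^esub> b = a + b"
  "r \<odot>\<^bsub>trivial_module\<^esub> a = a * augmentation r"
  by (simp_all add: trivial_module_def)

lemma bar_module_add [simp]: "c \<oplus>\<^bsub>bar_module G n\<^esub> d = c + d"
  by (simp add: bar_module_def)

context bar_group
begin

section \<open>Arithmetic of the integral group ring\<close>

lemma group_ring_mult:
  "r \<otimes>\<^bsub>group_ring G\<^esub> s = frag_extend (\<lambda>g. frag_extend (\<lambda>h. frag_of (g \<otimes> h)) s) r"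
  by (simp add: group_ring_def)

lemma group_ring_one [simp]: "\<one>\<^bsub>group_ring G\<^esub> = frag_of \<one>"
  by (simp add: group_ring_def)

lemma group_ring_carrier [simp]: "r \<in> carrier (group_ring G) \<longleftrightarrow> Poly_Mapping.keys r \<subseteq> carrier G"
  by (simp add: group_ring_def)

lemma group_ring_mult_zero [simp]:
  "0 \<otimes>\<^bsub>group_ring G\<^esub> s = 0" "r \<otimes>\<^bsub>group_ring G\<^esub> 0 = 0"
  by (simp_all add: group_ring_mult frag_extend_eq_0)

lemma group_ring_distrib:
  "(r + r') \<otimes>\<^bsub>group_ring G\<^esub> s = r \<otimes>\<^bsub>group_ring G\<^esub> s + r' \<otimes>\<^bsub>group_ring G\<^esub> s"
  "r \<otimes>\<^bsub>group_ring G\<^esub> (s + s') = r \<otimes>\<^bsub>group_ring G\<^esub> s + r \<otimes>\<^bsub>group_ring G\<^esub> s'"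
  by (simp_all add: group_ring_mult frag_extend_add frag_extend_distrib)

lemma group_ring_diff:
  "(r - r') \<otimes>\<^bsub>group_ring G\<^esub> s = r \<otimes>\<^bsub>group_ring G\<^esub> s - r' \<otimes>\<^bsub>group_ring G\<^esub> s"
  "r \<otimes>\<^bsub>group_ring G\<^esub> (s - s') = r \<otimes>\<^bsub>group_ring G\<^esub> s - r \<otimes>\<^bsub>group_ring G\<^esub> s'"
  by (simp_all add: eq_diff_eq flip: group_ring_distrib)

lemma group_ring_mult_closed:
  assumes "Poly_Mapping.keys r \<subseteq> carrier G" "Poly_Mapping.keys s \<subseteq> carrier G"
  shows "Poly_Mapping.keys (r \<otimes>\<^bsub>group_ring G\<^esub> s) \<subseteq> carrier G"
proof -
  have "Poly_Mapping.keys (frag_extend (\<lambda>h. frag_of (g \<otimes> h)) s) \<subseteq> carrier G"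
    if "g \<in> carrier G" for g
    using assms that by (intro order_trans[OF keys_frag_extend]) auto
  then show ?thesis
    using assms unfolding group_ring_mult by (intro order_trans[OF keys_frag_extend]) auto
qed

lemma group_ring_mult_of [simp]:
  "frag_of g \<otimes>\<^bsub>group_ring G\<^esub> frag_of h = frag_of (g \<otimes> h)"
  by (simp add: group_ring_mult)

text \<open>By additivity in each factor, three nested inductions over differences of generators
  reduce the claim to elements of \<open>G\<close>.\<close>

lemma group_ring_assoc:
  assumes r: "Poly_Mapping.keys r \<subseteq> carrier G" and s: "Poly_Mapping.keys s \<subseteq> carrier G"
    and t: "Poly_Mapping.keys t \<subseteq> carrier G"
  shows "(r \<otimes>\<^bsub>group_ring G\<^esub> s) \<otimes>\<^bsub>group_ring G\<^esub> t
    = r \<otimes>\<^bsub>group_ring G\<^esub> (s \<otimes>\<^bsub>group_ring G\<^esub> t)"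
  using r
proof (induction r rule: frag_induction)
  case (one g)
  show ?case
    using s
  proof (induction s rule: frag_induction)
    case (one h)
    show ?case
      using t by (induction t rule: frag_induction)
        (use one \<open>g \<in> carrier G\<close> in \<open>simp_all add: group_ring_diff m_assoc\<close>)
  qed (simp_all add: group_ring_diff)
qed (simp_all add: group_ring_diff)

lemma group_ring_mult_one:
  assumes "Poly_Mapping.keys r \<subseteq> carrier G"
  shows "frag_of \<one> \<otimes>\<^bsub>group_ring G\<^esub> r = r" "r \<otimes>\<^bsub>group_ring G\<^esub> frag_of \<one> = r"
  using assms
  by (induction r rule: frag_induction) (simp_all add: group_ring_diff)

section \<open>Bar chains as modules over the group ring\<close>

lemma lookup_smult [simp]:
  "Poly_Mapping.lookup (r \<odot>\<^bsub>bar_module G n\<^esub> c) gs = r \<otimes>\<^bsub>group_ring G\<^esub> Poly_Mapping.lookup c gs"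
  \<comment> \<open>\<open>Poly_Mapping.map\<close> applies its function on the support only; off
    the support the formula holds because \<open>r\<close> times 0 is 0.\<close>
  by (simp add: bar_module_def Poly_Mapping.map.rep_eq when_def)

lemma smult_single:
  "r \<odot>\<^bsub>bar_module G n\<^esub> Poly_Mapping.single gs s
    = Poly_Mapping.single gs (r \<otimes>\<^bsub>group_ring G\<^esub> s)"
  by (rule poly_mapping_eqI) (simp add: lookup_single when_def)

lemma smult_zero [simp]: "0 \<odot>\<^bsub>bar_module G n\<^esub> c = 0" "r \<odot>\<^bsub>bar_module G n\<^esub> 0 = 0"
  by (rule poly_mapping_eqI, simp)+

lemma smult_distrib:
  "(r + s) \<odot>\<^bsub>bar_module G n\<^esub> c = r \<odot>\<^bsub>bar_module G n\<^esub> c + s \<odot>\<^bsub>bar_module G n\<^esub> c"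
  "r \<odot>\<^bsub>bar_module G n\<^esub> (c + d) = r \<odot>\<^bsub>bar_module G n\<^esub> c + r \<odot>\<^bsub>bar_module G n\<^esub> d"
  by (rule poly_mapping_eqI, simp add: lookup_add group_ring_distrib)+

lemma smult_sum:
  "r \<odot>\<^bsub>bar_module G n\<^esub> sum f I = (\<Sum>i\<in>I. r \<odot>\<^bsub>bar_module G n\<^esub> f i)"
  by (induction I rule: infinite_finite_induct) (simp_all add: smult_distrib)

lemma bar_module_carrier:
  "c \<in> carrier (bar_module G n) \<longleftrightarrow>
    (\<forall>gs\<in>Poly_Mapping.keys c. length gs = n \<and> set gs \<subseteq> carrier G) \<and>
    (\<forall>gs. Poly_Mapping.keys (Poly_Mapping.lookup c gs) \<subseteq> carrier G)"
  by (simp add: bar_module_def)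

lemma bar_module_zero_closed: "0 \<in> carrier (bar_module G n)"
  by (simp add: bar_module_carrier)

lemma bar_module_add_closed:
  assumes "c \<in> carrier (bar_module G n)" "d \<in> carrier (bar_module G n)"
  shows "c + d \<in> carrier (bar_module G n)"
proof -
  have "Poly_Mapping.keys (Poly_Mapping.lookup (c + d) gs) \<subseteq> carrier G" for gs
    unfolding lookup_add using assms
    by (intro order_trans[OF keys_add] Un_least) (simp_all add: bar_module_carrier)
  moreover have "length gs = n \<and> set gs \<subseteq> carrier G" if "gs \<in> Poly_Mapping.keys (c + d)" for gs
    using subsetD[OF keys_add that] assms unfolding bar_module_carrier by blast
  ultimately show ?thesis
    by (simp add: bar_module_carrier)
qed

lemma bar_module_sum_closed:
  "(\<And>i. i \<in> I \<Longrightarrow> f i \<in> carrier (bar_module G n)) \<Longrightarrow> sum f I \<in> carrier (bar_module G n)"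
  by (induction I rule: infinite_finite_induct)
    (auto simp: bar_module_zero_closed bar_module_add_closed)

text \<open>The degree \<open>m\<close> of the scalar multiplication is independent of the degree
  \<open>n\<close> of the chain, since the operation is the same in all degrees.\<close>

lemma bar_module_smult_closed:
  assumes "Poly_Mapping.keys r \<subseteq> carrier G" "c \<in> carrier (bar_module G n)"
  shows "r \<odot>\<^bsub>bar_module G m\<^esub> c \<in> carrier (bar_module G n)"
proof -
  have "Poly_Mapping.keys (r \<odot>\<^bsub>bar_module G m\<^esub> c) \<subseteq> Poly_Mapping.keys c"
    by (force simp: in_keys_iff)
  then show ?thesis
    using assms by (auto simp: bar_module_carrier dest!: subsetD[OF group_ring_mult_closed, rotated 2])
qed

lemma bar_module_single_closed:
  "\<lbrakk>length gs = n; set gs \<subseteq> carrier G; Poly_Mapping.keys r \<subseteq> carrier G\<rbrakk>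
    \<Longrightarrow> Poly_Mapping.single gs r \<in> carrier (bar_module G n)"
  by (auto simp: bar_module_carrier lookup_single when_def split: if_splits)

lemma smult_assoc:
  assumes "Poly_Mapping.keys r \<subseteq> carrier G" "Poly_Mapping.keys s \<subseteq> carrier G"
    "c \<in> carrier (bar_module G n)"
  shows "(r \<otimes>\<^bsub>group_ring G\<^esub> s) \<odot>\<^bsub>bar_module G m\<^esub> c
    = r \<odot>\<^bsub>bar_module G m\<^esub> (s \<odot>\<^bsub>bar_module G m\<^esub> c)"
  by (rule poly_mapping_eqI) (use assms in \<open>simp add: group_ring_assoc bar_module_carrier\<close>)

lemma smult_one:
  assumes "c \<in> carrier (bar_module G n)"
  shows "frag_of \<one> \<odot>\<^bsub>bar_module G m\<^esub> c = c"
  by (rule poly_mapping_eqI) (use assms in \<open>simp add: group_ring_mult_one bar_module_carrier\<close>)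

section \<open>The boundary as a linear map over the group ring\<close>

lemma bar_boundary_sym_closed:
  assumes "length gs = n" "set gs \<subseteq> carrier G"
  shows "bar_boundary_sym G gs \<in> carrier (bar_module G (n - 1))"
proof (cases "gs = []")
  case False
  have "set (tl gs) \<subseteq> carrier G" "set (butlast gs) \<subseteq> carrier G" "hd gs \<in> carrier G"
    using assms False by (auto dest: in_set_butlastD list.set_sel(2))
  moreover have "gs ! i \<in> carrier G" if "i < length gs" for i
    using that assms(2) nth_mem by blast
  moreover have "set (take i gs) \<subseteq> carrier G" "set (drop i gs) \<subseteq> carrier G" for i
    using assms(2) by (auto dest: in_set_takeD in_set_dropD)
  ultimately show ?thesis
    using assms(1) False unfolding bar_boundary_sym_def if_not_P[OF False]
    by (intro bar_module_add_closed bar_module_sum_closed bar_module_single_closed)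
      (simp_all, auto)
qed (simp add: bar_boundary_sym_def bar_module_zero_closed)

text \<open>Supports of sums and multiples can shrink by cancellation; a common larger index set
  makes the boundaries comparable term by term.\<close>

lemma bar_boundary_superset:
  assumes "finite I" "Poly_Mapping.keys c \<subseteq> I"
  shows "bar_boundary G n c =
    (\<Sum>gs\<in>I. Poly_Mapping.lookup c gs \<odot>\<^bsub>bar_module G (n - 1)\<^esub> bar_boundary_sym G gs)"
  unfolding bar_boundary_def
  by (rule sum.mono_neutral_left) (use assms in \<open>auto simp: in_keys_iff\<close>)

lemma bar_boundary_add: "bar_boundary G n (c + d) = bar_boundary G n c + bar_boundary G n d"
proof -
  let ?I = "Poly_Mapping.keys c \<union> Poly_Mapping.keys d"
  have "Poly_Mapping.keys (c + d) \<subseteq> ?I"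
    by (rule keys_add)
  then show ?thesis
    by (simp add: bar_boundary_superset[of ?I] lookup_add smult_distrib sum.distrib)
qed

lemma bar_boundary_smult:
  assumes "Poly_Mapping.keys r \<subseteq> carrier G" "c \<in> carrier (bar_module G n)"
  shows "bar_boundary G n (r \<odot>\<^bsub>bar_module G n\<^esub> c)
    = r \<odot>\<^bsub>bar_module G (n - 1)\<^esub> bar_boundary G n c"
proof -
  \<comment> \<open>Only an inclusion, as a product in the group ring may vanish; both boundaries
    are therefore expanded over the support of \<open>c\<close>.\<close>
  have "Poly_Mapping.keys (r \<odot>\<^bsub>bar_module G n\<^esub> c) \<subseteq> Poly_Mapping.keys c"
    by (force simp: in_keys_iff)
  moreover have "(r \<otimes>\<^bsub>group_ring G\<^esub> Poly_Mapping.lookup c gs)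
      \<odot>\<^bsub>bar_module G (n - 1)\<^esub> bar_boundary_sym G gs
    = r \<odot>\<^bsub>bar_module G (n - 1)\<^esub>
      (Poly_Mapping.lookup c gs \<odot>\<^bsub>bar_module G (n - 1)\<^esub> bar_boundary_sym G gs)"
    if "gs \<in> Poly_Mapping.keys c" for gs
    using assms that
    by (intro smult_assoc[OF _ _ bar_boundary_sym_closed[OF refl]]) (auto simp: bar_module_carrier)
  ultimately show ?thesis
    by (simp add: bar_boundary_superset[of "Poly_Mapping.keys c"] smult_sum)
qed

lemma bar_boundary_closed:
  "c \<in> carrier (bar_module G n) \<Longrightarrow> bar_boundary G n c \<in> carrier (bar_module G (n - 1))"
  unfolding bar_boundary_def
  by (intro bar_module_sum_closed bar_module_smult_closed bar_boundary_sym_closed)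
    (auto simp: bar_module_carrier)

lemma bar_sym_closed:
  "\<lbrakk>length gs = n; set gs \<subseteq> carrier G\<rbrakk> \<Longrightarrow> bar_sym G gs \<in> carrier (bar_module G n)"
  unfolding bar_sym_def by (rule bar_module_single_closed) auto

lemma bar_boundary_bar_sym:
  assumes "length gs = n" "set gs \<subseteq> carrier G"
  shows "bar_boundary G n (bar_sym G gs) = bar_boundary_sym G gs"
  using smult_one[OF bar_boundary_sym_closed[OF assms]]
  by (simp add: bar_boundary_def bar_sym_def)

section \<open>Coinvariants of the bar resolution\<close>

lemma tensor_factors_bar:
  "tensor_factors (group_ring G) trivial_module (bar_module G n)"
  by unfold_locales (simp_all add: bar_module_add_closed bar_module_smult_closed)

sublocale bar: tensor_factors "group_ring G" trivial_module "bar_module G n" for n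
  by (rule tensor_factors_bar)

text \<open>Additivity in the left factor pulls the integer out of the tensor, one unit at a time in
  either direction from 0.\<close>

lemma frag_of_scale:
  assumes m: "m \<in> carrier (bar_module G n)"
  shows "frag_of (k, m) - frag_cmul k (frag_of (1, m)) \<in> bar.ker n"
proof (induction k rule: int_induct[where k = 0])
  case base
  show ?case
    \<comment> \<open>The relation for \<open>0 + 0\<close> is
      \<open>- frag_of (0, m)\<close>.\<close>
    using bar.tensor_kernel_uminus[OF bar.frag_of_add_left[of 0 0, OF _ _ m]] by simp
next
  case (step1 k)
  have "frag_of (k + 1, m) - frag_of (k, m) - frag_of (1, m) \<in> bar.ker n"
    using bar.frag_of_add_left[of k 1, OF _ _ m] by simp
  from bar.tensor_kernel_add[OF this step1(2)] show ?case
    by (simp add: frag_cmul_distrib algebra_simps)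
next
  case (step2 k)
  have "frag_of (k, m) - frag_of (k - 1, m) - frag_of (1, m) \<in> bar.ker n"
    using bar.frag_of_add_left[of "k - 1" 1, OF _ _ m] by simp
  from bar.tensor_kernel_diff[OF step2(2) this] show ?case
    by (simp add: frag_cmul_diff_distrib algebra_simps)
qed

text \<open>The coinvariants are free abelian on the elements \<open>1 \<otimes> [g|...]\<close>, so
  integer combinations of symbols serve as normal forms. This map sends a normal form to a
  representative in the free abelian group on pairs.\<close>

definition lift_syms :: "('a list \<Rightarrow>\<^sub>0 int) \<Rightarrow> (int \<times> 'a bar_chain \<Rightarrow>\<^sub>0 int)" where
  "lift_syms = frag_extend (\<lambda>gs. frag_of (1, bar_sym G gs))"

lemma lift_syms_simps:
  "lift_syms (p + q) = lift_syms p + lift_syms q"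
  "lift_syms (p - q) = lift_syms p - lift_syms q"
  "lift_syms (- p) = - lift_syms p"
  "lift_syms (frag_cmul k p) = frag_cmul k (lift_syms p)"
  "lift_syms (frag_of gs) = frag_of (1, bar_sym G gs)"
  "lift_syms 0 = 0"
  by (simp_all add: lift_syms_def frag_extend_add frag_extend_diff frag_extend_minus
      frag_extend_cmul)

text \<open>The chain is \<open>r\<close> times a symbol; moving \<open>r\<close> across the tensor
  sign leaves only its augmentation, by which it acts on the trivial module.\<close>

lemma frag_of_single:
  assumes gs: "length gs = n" "set gs \<subseteq> carrier G" and r: "Poly_Mapping.keys r \<subseteq> carrier G"
  shows "frag_of (k, Poly_Mapping.single gs r)
    - lift_syms (frag_cmul (k * augmentation r) (frag_of gs)) \<in> bar.ker n"
proof -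
  have sym: "bar_sym G gs \<in> carrier (bar_module G n)"
    using gs by (rule bar_sym_closed)
  have "r \<odot>\<^bsub>bar_module G n\<^esub> bar_sym G gs = Poly_Mapping.single gs r"
    using r by (simp add: bar_sym_def smult_single group_ring_mult_one)
  then have "frag_of (k * augmentation r, bar_sym G gs) - frag_of (k, Poly_Mapping.single gs r)
      \<in> bar.ker n"
    using bar.frag_of_smult[OF _ _ sym, of r k] r by simp
  from bar.tensor_kernel_diff[OF frag_of_scale[OF sym, of "k * augmentation r"] this] show ?thesis
    by (simp add: lift_syms_simps del: minus_frag_cmul)
qed

text \<open>The coefficient \<open>g\<close> of the first face has augmentation 1 and disappears,
  leaving \<open>[x|y]\<close>. The other three faces form, up to sign, the triangle of edges
  computed in \<open>path_sum_basic_relator\<close>.\<close>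

lemma frag_of_boundary:
  assumes "g \<in> carrier G" "x \<in> carrier G" "y \<in> carrier G"
  shows "frag_of (k, bar_boundary G 3 (bar_sym G [g, x, y]))
    - lift_syms (frag_cmul k (frag_of [x, y] - frag_of [g \<otimes> x, y] + frag_of [g, x \<otimes> y]
        - frag_of [g, x])) \<in> bar.ker 2"
proof -
  let ?a = "Poly_Mapping.single [x, y] (frag_of g)"
  let ?b = "Poly_Mapping.single [g \<otimes> x, y] (frag_cmul (-1) (frag_of \<one>))"
  let ?c = "Poly_Mapping.single [g, x \<otimes> y] (frag_cmul 1 (frag_of \<one>))"
  let ?d = "Poly_Mapping.single [g, x] (frag_cmul (-1) (frag_of \<one>))"
  have closed: "?a \<in> carrier (bar_module G 2)" "?b \<in> carrier (bar_module G 2)"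
    "?c \<in> carrier (bar_module G 2)" "?d \<in> carrier (bar_module G 2)"
    using assms by (auto intro!: bar_module_single_closed)
  \<comment> \<open>The inner faces of a degree 3 symbol: \<open>i = 1\<close> multiplies the first
    two entries, \<open>i = 2\<close> the last two. Their sum is the bracket \<open>?b + ?c\<close>
    in \<open>eq\<close>.\<close>
  have "{1..<3} = {1, 2::nat}"
    by auto
  then have eq: "bar_boundary G 3 (bar_sym G [g, x, y]) = ?a + (?b + ?c) + ?d"
    using assms by (subst bar_boundary_bar_sym) (auto simp: bar_boundary_sym_def eval_nat_numeral)
  have "frag_of (k, ?a + (?b + ?c) + ?d) - frag_of (k, ?a + (?b + ?c)) - frag_of (k, ?d) \<in> bar.ker 2"
    "frag_of (k, ?a + (?b + ?c)) - frag_of (k, ?a) - frag_of (k, ?b + ?c) \<in> bar.ker 2"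
    "frag_of (k, ?b + ?c) - frag_of (k, ?b) - frag_of (k, ?c) \<in> bar.ker 2"
    using closed
    by (auto intro!: bar.frag_of_add_right[of _ _ 2, unfolded bar_module_add] bar_module_add_closed
        simp del: frag_cmul_minus_one frag_cmul_one)
  moreover have
    "frag_of (k, ?a) - lift_syms (frag_cmul (k * 1) (frag_of [x, y])) \<in> bar.ker 2"
    "frag_of (k, ?b) - lift_syms (frag_cmul (k * (-1)) (frag_of [g \<otimes> x, y])) \<in> bar.ker 2"
    "frag_of (k, ?c) - lift_syms (frag_cmul (k * 1) (frag_of [g, x \<otimes> y])) \<in> bar.ker 2"
    "frag_of (k, ?d) - lift_syms (frag_cmul (k * (-1)) (frag_of [g, x])) \<in> bar.ker 2"
    using assms frag_of_single[of "[x, y]" 2 "frag_of g" k]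
      frag_of_single[of "[g \<otimes> x, y]" 2 "frag_cmul (-1) (frag_of \<one>)" k]
      frag_of_single[of "[g, x \<otimes> y]" 2 "frag_cmul 1 (frag_of \<one>)" k]
      frag_of_single[of "[g, x]" 2 "frag_cmul (-1) (frag_of \<one>)" k]
    unfolding augmentation_simps by simp_all
  \<comment> \<open>The seven kernel elements telescope: all intermediate terms cancel, leaving the
    boundary minus the four lifted symbols.\<close>
  ultimately have "(frag_of (k, ?a + (?b + ?c) + ?d) - frag_of (k, ?a + (?b + ?c)) - frag_of (k, ?d))
     + (frag_of (k, ?a + (?b + ?c)) - frag_of (k, ?a) - frag_of (k, ?b + ?c))
     + (frag_of (k, ?b + ?c) - frag_of (k, ?b) - frag_of (k, ?c))
     + (frag_of (k, ?a) - lift_syms (frag_cmul (k * 1) (frag_of [x, y])))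
     + (frag_of (k, ?b) - lift_syms (frag_cmul (k * (-1)) (frag_of [g \<otimes> x, y])))
     + (frag_of (k, ?c) - lift_syms (frag_cmul (k * 1) (frag_of [g, x \<otimes> y])))
     + (frag_of (k, ?d) - lift_syms (frag_cmul (k * (-1)) (frag_of [g, x]))) \<in> bar.ker 2"
    by (intro bar.tensor_kernel_add)
  also have "?this \<longleftrightarrow> ?thesis"
    unfolding eq
    by (simp add: lift_syms_simps frag_cmul_distrib2 frag_cmul_minus_right algebra_simps
        flip: minus_frag_cmul)
  finally show ?thesis .
qed

end

section \<open>Path sums and written products\<close>

text \<open>An inverse letter read at \<open>g\<close> runs backwards along the edge that starts at
  \<open>g x^-1\<close>, which explains the first entry of the subtracted symbol. For
  \<open>g = 1\<close> these are the Fox derivatives of the word, mapped to the group ring, with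
  \<open>h\<close> in the component of \<open>x\<close> recorded as \<open>[h|x]\<close>.\<close>

fun path_sum :: "('a, 'b) monoid_scheme \<Rightarrow> 'a \<Rightarrow> 'a fword \<Rightarrow> ('a list \<Rightarrow>\<^sub>0 int)" where
  "path_sum G g [] = 0"
| "path_sum G g ((x, True) # w) = frag_of [g, x] + path_sum G (g \<otimes>\<^bsub>G\<^esub> x) w"
| "path_sum G g ((x, False) # w) =
     path_sum G (g \<otimes>\<^bsub>G\<^esub> inv\<^bsub>G\<^esub> x) w - frag_of [g \<otimes>\<^bsub>G\<^esub> inv\<^bsub>G\<^esub> x, x]"

definition word_value :: "('a, 'b) monoid_scheme \<Rightarrow> 'a factor list \<Rightarrow> 'a fword" where
  "word_value G w = ordered_prod (free_group_on G) (map (factor_value G) w)"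

definition factor_ok :: "('a, 'b) monoid_scheme \<Rightarrow> 'a factor \<Rightarrow> bool" where
  "factor_ok G = (\<lambda>(u, x, y, n).
     u \<in> carrier (free_group_on G) \<and> x \<in> carrier G \<and> y \<in> carrier G)"

definition inverse_word :: "'a factor list \<Rightarrow> 'a factor list" where
  "inverse_word w = map (\<lambda>(u, x, y, n). (u, x, y, - n)) (rev w)"

definition symbol_sum :: "'a factor list \<Rightarrow> ('a list \<Rightarrow>\<^sub>0 int)" where
  "symbol_sum w = (\<Sum>(u, x, y, n)\<leftarrow>w. frag_cmul n (frag_of [x, y]))"

section \<open>Degree 2 symbols of a written product\<close>

lemma symbol_sum_simps [simp]:
  "symbol_sum [] = 0"
  "symbol_sum ((u, x, y, n) # w) = frag_cmul n (frag_of [x, y]) + symbol_sum w"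
  "symbol_sum (w @ w') = symbol_sum w + symbol_sum w'"
  by (simp_all add: symbol_sum_def)

lemma symbol_sum_inverse_word: "symbol_sum (inverse_word w) = - symbol_sum w"
  by (induction w) (auto simp: inverse_word_def simp flip: minus_frag_cmul)

text \<open>Brings the inverted half of an expanded commutator under the facts about
  \<open>inverse_word\<close>.\<close>

lemma conj_inv_expr_eq: "conj_inv_expr u E = inverse_word (conj_expr u E)"
  by (simp add: conj_inv_expr_def conj_expr_def inverse_word_def rev_map case_prod_unfold comp_def)

lemma symbol_sum_conj_expr: "symbol_sum (conj_expr u E) = symbol_sum (conj_expr u' E)"
  by (induction E) (auto simp: conj_expr_def)

text \<open>Symbol sums do not see conjugators, so the halves for \<open>R\<close> and its inverse
  cancel, whichever of them is conjugated by \<open>u\<close>.\<close>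

lemma symbol_sum_expand_commutator: "symbol_sum (expand_commutator G c E) = 0"
proof -
  obtain R u e where c: "c = (R, u, e)" by (cases c)
  show ?thesis
    using symbol_sum_conj_expr[of u E "\<one>\<^bsub>free_group_on G\<^esub>"]
    by (simp add: c expand_commutator_def Let_def conj_inv_expr_eq symbol_sum_inverse_word)
qed

lemma symbol_sum_expand_commutators: "symbol_sum (expand_commutators G cs Es) = 0"
proof (induction cs arbitrary: Es)
  case (Cons c cs)
  then show ?case
    \<comment> \<open>The lists may differ in length: \<open>map2\<close> stops at the shorter one,
      and an empty expansion has sum 0.\<close>
    by (cases Es) (auto simp: expand_commutators_def symbol_sum_expand_commutator)
qed (simp add: expand_commutators_def)

lemma symbol_sum_side_word:
  "symbol_sum (side_word G k C E v x y n) = (\<Sum>i\<in>{1..k}. frag_cmul (n i) (frag_of [x i, y i]))"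
proof -
  \<comment> \<open>Generalised from \<open>[1..<k + 1]\<close> to any index list for the
    induction.\<close>
  have "symbol_sum (concat (map (\<lambda>i. expand_commutators G (C i) (E i) @ [(v i, x i, y i, n i)]) is))
      = (\<Sum>i\<leftarrow>is. frag_cmul (n i) (frag_of [x i, y i]))" for "is"
    by (induction "is") (simp_all add: symbol_sum_expand_commutators)
  moreover have "{1..<k + 1} = {1..k}"
    by auto
  ultimately show ?thesis
    by (simp add: side_word_def symbol_sum_expand_commutators sum_list_distinct_conv_sum_set
        del: upt_Suc)
qed

section \<open>Ordered products in monoids and groups\<close>

lemma (in monoid) ordered_prod_closed: "set xs \<subseteq> carrier G \<Longrightarrow> ordered_prod G xs \<in> carrier G"
  by (induction xs) (auto simp: ordered_prod_def)

lemma (in monoid) ordered_prod_append: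
  "\<lbrakk>set xs \<subseteq> carrier G; set ys \<subseteq> carrier G\<rbrakk>
    \<Longrightarrow> ordered_prod G (xs @ ys) = ordered_prod G xs \<otimes> ordered_prod G ys"
  using ordered_prod_closed
  by (induction xs) (auto simp: ordered_prod_def m_assoc)

lemma (in group) ordered_prod_inv:
  "set xs \<subseteq> carrier G \<Longrightarrow> inv (ordered_prod G xs) = ordered_prod G (rev (map (m_inv G) xs))"
proof (induction xs)
  case (Cons x xs)
  have "set (rev (map (m_inv G) xs)) \<subseteq> carrier G"
    using Cons.prems by auto
  then have "ordered_prod G (rev (map (m_inv G) (x # xs)))
      = ordered_prod G (rev (map (m_inv G) xs)) \<otimes> ordered_prod G [inv x]"
    using Cons.prems by (simp add: ordered_prod_append)
  moreover have "ordered_prod G (x # xs) = x \<otimes> ordered_prod G xs" "ordered_prod G [inv x] = inv x"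
    using Cons.prems by (simp_all add: ordered_prod_def)
  ultimately show ?case
    using Cons ordered_prod_closed by (simp add: inv_mult_group)
qed (simp add: ordered_prod_def)

context bar_group
begin

section \<open>Path sums on the free group\<close>

sublocale FG: group "free_group_on G"
  by (rule group_free_group)

abbreviation "F \<equiv> free_group_on G"

lemma eval_hom_closed: "v \<in> carrier F \<Longrightarrow> eval_hom G v \<in> carrier G"
  using hom_in_carrier[OF eval_hom_hom[OF is_group]] .

sublocale ev: group_hom F G "eval_hom G"
  by (simp add: group_hom_def group_hom_axioms_def is_group FG.is_group eval_hom_hom)

text \<open>A cancelling pair of letters runs along one edge forth and back: it contributes 0 and
  returns to \<open>g\<close>. Path sums are thus compatible with free reduction.\<close>

lemma path_sum_prepend:
  assumes "g \<in> carrier G" "set (p # w) \<subseteq> carrier G \<times> UNIV"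
  shows "path_sum G g (prepend_letter p w) = path_sum G g (p # w)"
proof (cases w)
  case (Cons q w')
  obtain x b y c where "p = (x, b)" "q = (y, c)"
    by (metis surj_pair)
  then show ?thesis
    using assms Cons
    by (cases b; cases c) (auto simp: inverse_letters_def m_assoc)
qed simp

text \<open>A crossed homomorphism rule: the path of \<open>w\<close> starts where the path of
  \<open>v\<close> ends.\<close>

lemma path_sum_mult:
  assumes g: "g \<in> carrier G" and v: "v \<in> carrier F" and w: "w \<in> carrier F"
  shows "path_sum G g (v \<otimes>\<^bsub>F\<^esub> w) = path_sum G g v + path_sum G (g \<otimes> eval_hom G v) w"
proof -
  have ev: "eval_hom G v \<in> carrier G" if "set v \<subseteq> carrier G \<times> UNIV" for v
    using that by (induction v) (auto simp: eval_hom_def)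
  have "set v \<subseteq> carrier G \<times> UNIV" "set w \<subseteq> carrier G \<times> UNIV"
    using v w by (auto simp: free_group_def)
  \<comment> \<open>The induction follows the letters of \<open>v\<close>; the start
    \<open>g\<close> is generalised because each letter moves it to the next vertex.\<close>
  then have "path_sum G g (foldr prepend_letter v w)
      = path_sum G g v + path_sum G (g \<otimes> eval_hom G v) w"
    using g
  proof (induction v arbitrary: g)
    case Nil
    then show ?case by (simp add: eval_hom_def)
  next
    case (Cons p v)
    obtain x b where p: "p = (x, b)"
      by (metis surj_pair)
    have x: "x \<in> carrier G" and v: "set v \<subseteq> carrier G \<times> UNIV"
      using Cons.prems p by auto
    have "set (p # foldr prepend_letter v w) \<subseteq> carrier G \<times> UNIV"
      using Cons.prems foldr_prepend_letter_set[of v w] by auto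
    from path_sum_prepend[OF Cons.prems(3) this]
    have "path_sum G g (foldr prepend_letter (p # v) w)
        = path_sum G g (p # foldr prepend_letter v w)"
      by simp
    moreover have "eval_hom G (p # v) = (if b then x else inv x) \<otimes> eval_hom G v"
      by (simp add: p eval_hom_def)
    ultimately show ?case
      using Cons.IH[OF v Cons.prems(2)] Cons.prems(3) x ev[OF v]
      by (cases b) (simp_all add: p m_assoc algebra_simps)
  qed
  then show ?thesis by (simp add: free_group_def)
qed

lemma path_sum_one: "path_sum G g \<one>\<^bsub>F\<^esub> = 0"
  by (simp add: free_group_def)

text \<open>The reversed path starts at the endpoint of the path of \<open>v\<close>; the two
  together spell the empty word, whose sum is 0.\<close>

lemma path_sum_inv:
  assumes "g \<in> carrier G" "v \<in> carrier F"
  shows "path_sum G (g \<otimes> eval_hom G v) (inv\<^bsub>F\<^esub> v) = - path_sum G g v"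
  using path_sum_mult[OF assms FG.inv_closed[OF assms(2)]] assms
  by (simp add: path_sum_one eq_neg_iff_add_eq_0 add.commute)

text \<open>Since \<open>r\<close> evaluates to \<open>\<one>\<close>, its path is a loop and every
  turn starts again at \<open>g\<close>.\<close>

lemma path_sum_nat_pow:
  assumes "g \<in> carrier G" "r \<in> carrier F" "eval_hom G r = \<one>"
  shows "path_sum G g (r [^]\<^bsub>F\<^esub> (n::nat)) = frag_cmul (int n) (path_sum G g r)"
  using assms
  by (induction n)
    (simp_all add: path_sum_one path_sum_mult ev.hom_nat_pow frag_cmul_distrib add.commute)

lemma path_sum_int_pow:
  assumes "g \<in> carrier G" "r \<in> carrier F" "eval_hom G r = \<one>"
  shows "path_sum G g (r [^]\<^bsub>F\<^esub> (n::int)) = frag_cmul n (path_sum G g r)"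
proof (cases n)
  case (nonneg m)
  then show ?thesis by (simp add: int_pow_int path_sum_nat_pow[OF assms])
next
  case (neg m)
  \<comment> \<open>Here \<open>n = - int (Suc m)\<close>. The positive power is still a loop, so
    its reversal also starts at \<open>g\<close>.\<close>
  have "path_sum G g (inv\<^bsub>F\<^esub> (r [^]\<^bsub>F\<^esub> Suc m)) = - path_sum G g (r [^]\<^bsub>F\<^esub> Suc m)"
    using path_sum_inv[of g "r [^]\<^bsub>F\<^esub> Suc m"] assms ev.hom_nat_pow[of r "Suc m"]
    by (simp del: nat_pow_Suc FG.nat_pow_Suc)
  moreover have "r [^]\<^bsub>F\<^esub> n = inv\<^bsub>F\<^esub> (r [^]\<^bsub>F\<^esub> Suc m)"
    using FG.int_pow_neg_int[OF assms(2), of "Suc m"] neg by simp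
  ultimately show ?thesis
    using path_sum_nat_pow[OF assms, of "Suc m"] neg by simp
qed

lemma basic_relator_closed: "\<lbrakk>x \<in> carrier G; y \<in> carrier G\<rbrakk> \<Longrightarrow> basic_relator G x y \<in> carrier F"
  by (simp add: basic_relator_def free_gen_closed)

lemma eval_hom_basic_relator:
  "\<lbrakk>x \<in> carrier G; y \<in> carrier G\<rbrakk> \<Longrightarrow> eval_hom G (basic_relator G x y) = \<one>"
  by (simp add: basic_relator_def free_gen_closed eval_hom_free_gen is_group)

text \<open>The triangle with vertices \<open>g\<close>, \<open>gx\<close>, \<open>gxy\<close>: two
  edges forwards, then the edge for \<open>xy\<close> backwards.\<close>

lemma path_sum_basic_relator:
  assumes "g \<in> carrier G" "x \<in> carrier G" "y \<in> carrier G"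
  shows "path_sum G g (basic_relator G x y)
    = frag_of [g, x] + frag_of [g \<otimes> x, y] - frag_of [g, x \<otimes> y]"
proof -
  have gen: "path_sum G h (free_gen z) = frag_of [h, z]" for h z
    by (simp add: free_gen_def)
  have "path_sum G (g \<otimes> (x \<otimes> y)) (inv\<^bsub>F\<^esub> free_gen (x \<otimes> y)) = - frag_of [g, x \<otimes> y]"
    using path_sum_inv[of g "free_gen (x \<otimes> y)"] assms
    by (simp add: free_gen_closed eval_hom_free_gen is_group gen)
  then show ?thesis
    using assms
    by (simp add: basic_relator_def free_gen_closed eval_hom_free_gen is_group path_sum_mult gen)
qed

lemma factor_value_closed: "factor_ok G f \<Longrightarrow> factor_value G f \<in> carrier F"
  by (auto simp: factor_ok_def factor_value_def basic_relator_closed)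

lemma eval_hom_int_pow_relator:
  assumes "x \<in> carrier G" "y \<in> carrier G"
  shows "eval_hom G (basic_relator G x y [^]\<^bsub>F\<^esub> (n::int)) = \<one>"
  using ev.hom_int_pow[of "basic_relator G x y" n] assms
  by (simp add: basic_relator_closed eval_hom_basic_relator)

lemma eval_hom_factor_value: "factor_ok G f \<Longrightarrow> eval_hom G (factor_value G f) = \<one>"
  by (auto simp: factor_ok_def factor_value_def basic_relator_closed eval_hom_int_pow_relator)

text \<open>The path of \<open>u\<close> is run out and back and cancels, because the power of the
  relator in between is a loop at \<open>eval_hom G u\<close>.\<close>

lemma path_sum_factor_value:
  assumes "factor_ok G (u, x, y, n)"
  shows "path_sum G \<one> (factor_value G (u, x, y, n)) = frag_cmul n
    (frag_of [eval_hom G u, x] + frag_of [eval_hom G u \<otimes> x, y] - frag_of [eval_hom G u, x \<otimes> y])"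
proof -
  have ok: "u \<in> carrier F" "x \<in> carrier G" "y \<in> carrier G"
    using assms by (auto simp: factor_ok_def)
  then show ?thesis
    using path_sum_inv[of \<one> u]
    by (simp add: factor_value_def path_sum_mult basic_relator_closed path_sum_int_pow
        eval_hom_basic_relator eval_hom_int_pow_relator path_sum_basic_relator)
qed

section \<open>Values of written products\<close>

lemma word_value_closed: "list_all (factor_ok G) w \<Longrightarrow> word_value G w \<in> carrier F"
  unfolding word_value_def
  by (rule FG.ordered_prod_closed) (auto simp: list_all_iff factor_value_closed)

text \<open>Every factor evaluates to \<open>\<one>\<close>, so each of their paths starts at
  \<open>\<one>\<close> and the sums simply add up.\<close>

lemma path_sum_word_value:
  assumes "list_all (factor_ok G) w"
  shows "path_sum G \<one> (word_value G w) = (\<Sum>(u, x, y, n)\<leftarrow>w. frag_cmul n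
    (frag_of [eval_hom G u, x] + frag_of [eval_hom G u \<otimes> x, y] - frag_of [eval_hom G u, x \<otimes> y]))"
  using assms
proof (induction w)
  case Nil
  then show ?case by (simp add: word_value_def ordered_prod_def path_sum_one)
next
  case (Cons f w)
  then have ok: "factor_ok G f" "list_all (factor_ok G) w" by auto
  have "word_value G (f # w) = factor_value G f \<otimes>\<^bsub>F\<^esub> word_value G w"
    by (simp add: word_value_def ordered_prod_def)
  then have "path_sum G \<one> (word_value G (f # w))
      = path_sum G \<one> (factor_value G f) + path_sum G \<one> (word_value G w)"
    using ok by (simp add: path_sum_mult factor_value_closed word_value_closed eval_hom_factor_value)
  then show ?case
    using Cons.IH[OF ok(2)] ok(1) path_sum_factor_value by (cases f) simp
qed

lemma word_value_append:
  "\<lbrakk>list_all (factor_ok G) w; list_all (factor_ok G) w'\<rbrakk>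
    \<Longrightarrow> word_value G (w @ w') = word_value G w \<otimes>\<^bsub>F\<^esub> word_value G w'"
  unfolding word_value_def map_append
  by (rule FG.ordered_prod_append) (auto simp: list_all_iff factor_value_closed)

lemma word_value_Nil [simp]: "word_value G [] = \<one>\<^bsub>F\<^esub>"
  by (simp add: word_value_def ordered_prod_def)

lemma word_value_singleton: "factor_ok G f \<Longrightarrow> word_value G [f] = factor_value G f"
  by (simp add: word_value_def ordered_prod_def factor_value_closed)

lemma word_value_concat:
  assumes "\<And>w. w \<in> set ws \<Longrightarrow> list_all (factor_ok G) w"
  shows "word_value G (concat ws) = ordered_prod F (map (word_value G) ws)"
  using assms
proof (induction ws)
  case (Cons w ws)
  then have "list_all (factor_ok G) (concat ws)"
    by (auto simp: list_all_iff)
  with Cons show ?case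
    by (simp add: word_value_append ordered_prod_def)
qed (simp add: ordered_prod_def)

lemma factor_ok_inverse_word: "list_all (factor_ok G) w \<Longrightarrow> list_all (factor_ok G) (inverse_word w)"
  by (auto simp: list_all_iff inverse_word_def factor_ok_def)

lemma factor_value_uminus:
  assumes "factor_ok G (u, x, y, n)"
  shows "factor_value G (u, x, y, - n) = inv\<^bsub>F\<^esub> (factor_value G (u, x, y, n))"
  using assms
  by (auto simp: factor_ok_def factor_value_def FG.inv_mult_group FG.int_pow_neg
      basic_relator_closed FG.m_assoc)

lemma word_value_inverse_word:
  assumes "list_all (factor_ok G) w"
  shows "word_value G (inverse_word w) = inv\<^bsub>F\<^esub> (word_value G w)"
proof -
  have "map (factor_value G) (inverse_word w) = rev (map (m_inv F) (map (factor_value G) w))"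
    using assms
    by (auto simp: inverse_word_def rev_map list_all_iff factor_value_uminus)
  then show ?thesis
    using assms
    by (subst word_value_def)
      (auto simp: word_value_def FG.ordered_prod_inv list_all_iff factor_value_closed image_subset_iff)
qed

section \<open>Correctness of the expansion of commutators\<close>

lemma conj_expr_ok:
  assumes "u \<in> carrier F" "is_expr_of G E R"
  shows "list_all (factor_ok G) (conj_expr u E)"
  using assms by (auto simp: list_all_iff conj_expr_def factor_ok_def is_expr_of_def)

text \<open>Between neighbouring factors the inverse of \<open>u\<close> meets \<open>u\<close> and
  cancels, leaving only the outer conjugation.\<close>

lemma word_value_conj_expr:
  assumes u: "u \<in> carrier F" and "is_expr_of G E R"
  shows "word_value G (conj_expr u E) = u \<otimes>\<^bsub>F\<^esub> R \<otimes>\<^bsub>F\<^esub> inv\<^bsub>F\<^esub> u"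
proof -
  \<comment> \<open>\<open>R\<close> is the product of its expression; written as
    \<open>?p E\<close>, it varies with \<open>E\<close> in the induction.\<close>
  let ?p = "\<lambda>E. ordered_prod F (map (\<lambda>(a, b, m). basic_relator G a b [^]\<^bsub>F\<^esub> (m::int)) E)"
  have closed: "?p E \<in> carrier F" if "\<forall>(a, b, m)\<in>set E. a \<in> carrier G \<and> b \<in> carrier G" for E
    using that by (intro FG.ordered_prod_closed) (auto simp: basic_relator_closed)
  have "word_value G (conj_expr u E) = u \<otimes>\<^bsub>F\<^esub> ?p E \<otimes>\<^bsub>F\<^esub> inv\<^bsub>F\<^esub> u"
    if "\<forall>(a, b, m)\<in>set E. a \<in> carrier G \<and> b \<in> carrier G"
    using that
  proof (induction E)
    case Nil
    then show ?case using u by (simp add: conj_expr_def ordered_prod_def)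
  next
    case (Cons e E)
    obtain a b m where e: "e = (a, b, m)" by (cases e)
    let ?r = "basic_relator G a b [^]\<^bsub>F\<^esub> m"
    have r: "?r \<in> carrier F" and E: "?p E \<in> carrier F"
      using Cons.prems closed[of E] by (auto simp: e basic_relator_closed)
    have "word_value G (conj_expr u (e # E))
        = (u \<otimes>\<^bsub>F\<^esub> ?r \<otimes>\<^bsub>F\<^esub> inv\<^bsub>F\<^esub> u) \<otimes>\<^bsub>F\<^esub> word_value G (conj_expr u E)"
      by (simp add: e conj_expr_def word_value_def ordered_prod_def factor_value_def)
    also have "\<dots> = (u \<otimes>\<^bsub>F\<^esub> ?r \<otimes>\<^bsub>F\<^esub> inv\<^bsub>F\<^esub> u) \<otimes>\<^bsub>F\<^esub> (u \<otimes>\<^bsub>F\<^esub> ?p E \<otimes>\<^bsub>F\<^esub> inv\<^bsub>F\<^esub> u)"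
      using Cons by simp
    also have "\<dots> = u \<otimes>\<^bsub>F\<^esub> (?r \<otimes>\<^bsub>F\<^esub> ?p E) \<otimes>\<^bsub>F\<^esub> inv\<^bsub>F\<^esub> u"
      using u r E by (simp add: FG.m_assoc FG.inv_solve_left')
    finally show ?case by (simp add: e ordered_prod_def)
  qed
  then show ?thesis using assms(2) by (auto simp: is_expr_of_def)
qed

lemma expand_commutator_ok:
  assumes "commutator_ok G c" "is_expr_of G E (fst c)"
  shows "list_all (factor_ok G) (expand_commutator G c E)"
  using assms
  by (auto simp: expand_commutator_def Let_def conj_inv_expr_eq commutator_ok_def
      intro!: conj_expr_ok factor_ok_inverse_word)

lemma word_value_expand_commutator:
  assumes "commutator_ok G c" "is_expr_of G E (fst c)"
  shows "word_value G (expand_commutator G c E) = commutator_value G c"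
proof -
  obtain R u e where c: "c = (R, u, e)" by (cases c)
  have R: "R \<in> carrier F" and u: "u \<in> carrier F" and E: "is_expr_of G E R"
    using assms by (auto simp: c commutator_ok_def relators_def kernel_def)
  \<comment> \<open>The conjugator is left open: it is instantiated both with \<open>u\<close> and
    with the identity, the latter giving \<open>R\<close> itself.\<close>
  note ok = conj_expr_ok[OF _ E] and val = word_value_conj_expr[OF _ E]
  show ?thesis
    using R u
    by (simp add: c expand_commutator_def commutator_value_def Let_def conj_inv_expr_eq
        word_value_append ok factor_ok_inverse_word word_value_inverse_word val
        FG.inv_mult_group FG.m_assoc)
qed

lemma expand_commutators_correct:
  assumes "\<And>c. c \<in> set cs \<Longrightarrow> commutator_ok G c" "expressions_of G Es cs"
  shows "list_all (factor_ok G) (expand_commutators G cs Es)"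
    and "word_value G (expand_commutators G cs Es) = commutators_value G cs"
proof -
  have "list_all2 (\<lambda>E (R, u, e). is_expr_of G E R) Es cs"
    using assms(2) by (simp add: expressions_of_def)
  \<comment> \<open>The two claims are proved jointly, since \<open>word_value_append\<close> asks
    for well-formed factors in the remaining expansion.\<close>
  then have "list_all (factor_ok G) (expand_commutators G cs Es) \<and>
      word_value G (expand_commutators G cs Es) = commutators_value G cs"
    using assms(1)
  proof (induction rule: list_all2_induct)
    case Nil
    then show ?case by (simp add: expand_commutators_def commutators_value_def ordered_prod_def)
  next
    case (Cons E Es c cs)
    have c: "commutator_ok G c" "is_expr_of G E (fst c)"
      using Cons.hyps Cons.prems by auto
    have "expand_commutators G (c # cs) (E # Es)
        = expand_commutator G c E @ expand_commutators G cs Es"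
      by (simp add: expand_commutators_def)
    moreover have "commutators_value G (c # cs)
        = commutator_value G c \<otimes>\<^bsub>F\<^esub> commutators_value G cs"
      by (simp add: commutators_value_def ordered_prod_def)
    ultimately show ?case
      using Cons expand_commutator_ok[OF c]
      by (simp add: word_value_append word_value_expand_commutator[OF c])
  qed
  then show "list_all (factor_ok G) (expand_commutators G cs Es)"
    and "word_value G (expand_commutators G cs Es) = commutators_value G cs"
    by auto
qed

lemma side_word_correct:
  assumes "\<And>i c. i \<in> {1..k + 1} \<Longrightarrow> c \<in> set (C i) \<Longrightarrow> commutator_ok G c"
    and "\<And>i. i \<in> {1..k + 1} \<Longrightarrow> expressions_of G (E i) (C i)"
    and "\<And>i. i \<in> {1..k} \<Longrightarrow> x i \<in> carrier G \<and> y i \<in> carrier G \<and> v i \<in> carrier F"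
  shows "list_all (factor_ok G) (side_word G k C E v x y n)"
    and "word_value G (side_word G k C E v x y n) = side_value G k C v x y n"
proof -
  let ?w = "\<lambda>i. expand_commutators G (C i) (E i) @ [(v i, x i, y i, n i)]"
  have C: "list_all (factor_ok G) (expand_commutators G (C i) (E i))"
    "word_value G (expand_commutators G (C i) (E i)) = commutators_value G (C i)"
    if "i \<in> {1..k + 1}" for i
    using expand_commutators_correct[of "C i" "E i"] assms(1,2) that by blast+
  have f: "factor_ok G (v i, x i, y i, n i)" if "i \<in> {1..k}" for i
    using assms(3)[OF that] by (simp add: factor_ok_def)
  have w: "list_all (factor_ok G) (?w i)" if "i \<in> {1..k}" for i
    using that C(1)[of i] f by simp
  have "word_value G (?w i)
      = commutators_value G (C i) \<otimes>\<^bsub>F\<^esub> factor_value G (v i, x i, y i, n i)" if "i \<in> {1..k}" for i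
    using that C[of i] f by (simp add: word_value_append word_value_singleton)
  then have map: "map (word_value G) (map ?w [1..<k + 1])
      = map (\<lambda>i. commutators_value G (C i) \<otimes>\<^bsub>F\<^esub> factor_value G (v i, x i, y i, n i)) [1..<k + 1]"
    by (auto simp del: upt_Suc)
  have "list_all (factor_ok G) (concat (map ?w is))" if "set is \<subseteq> {1..k}" for "is"
    using that by (induction "is") (use w in simp_all)
  then have ok: "list_all (factor_ok G) (concat (map ?w [1..<k + 1]))"
    by (simp add: subset_iff del: upt_Suc)
  then show "list_all (factor_ok G) (side_word G k C E v x y n)"
    using C(1)[of "k + 1"] by (simp add: side_word_def del: upt_Suc)
  have "word_value G (concat (map ?w [1..<k + 1])) = ordered_prod F (map (word_value G) (map ?w [1..<k + 1]))"
    by (rule word_value_concat) (use w in auto)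
  then show "word_value G (side_word G k C E v x y n) = side_value G k C v x y n"
    using ok C[of "k + 1"] unfolding map
    by (simp add: side_word_def side_value_def word_value_append del: upt_Suc)
qed

end

section \<open>The boundary of a written product\<close>

context bar_group
begin

text \<open>A representative of \<open>W G w\<close>, with each exponent kept as the first entry of
  its pair, as in \<open>coinv_sym\<close>.\<close>

definition word_frag :: "'a factor list \<Rightarrow> (int \<times> 'a bar_chain \<Rightarrow>\<^sub>0 int)" where
  "word_frag w = (\<Sum>(u, x, y, n)\<leftarrow>w. frag_of (n, bar_sym G [eval_hom G u, x, y]))"

lemma coinv_sym_eq:
  "coinv_sym G n gs
    = tensor_class (group_ring G) trivial_module (bar_module G (length gs)) (frag_of (n, bar_sym G gs))"
  by (simp add: coinv_sym_def tensor_def)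

lemma frag_of_bar_sym_closed:
  assumes "length gs = q" "set gs \<subseteq> carrier G"
  shows "frag_of (k, bar_sym G gs) \<in> carrier (bar.frags q)"
  using bar_sym_closed[OF assms] by simp

lemma W_eq:
  assumes "list_all (factor_ok G) w"
  shows "W G w = bar.cls 3 (word_frag w)" and "word_frag w \<in> carrier (bar.frags 3)"
proof -
  let ?f = "\<lambda>i. case w ! i of (u, x, y, n) \<Rightarrow> frag_of (n, bar_sym G [eval_hom G u, x, y])"
  have closed: "?f i \<in> carrier (bar.frags 3)" if "i < length w" for i
  proof -
    have "factor_ok G (w ! i)"
      using assms that by (simp add: list_all_length)
    then show ?thesis
      by (auto simp: factor_ok_def eval_hom_closed intro!: bar_sym_closed)
  qed
  have sum: "sum ?f {..<length w} = word_frag w"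
    by (simp add: word_frag_def sum_list_sum_nth atLeast0LessThan)
  show "word_frag w \<in> carrier (bar.frags 3)"
    unfolding sum[symmetric] by (rule bar.frags_sum_closed) (use closed in auto)
  have "W G w = (\<Oplus>\<^bsub>bar.tens 3\<^esub>i\<in>{..<length w}. bar.cls 3 (?f i))"
    \<comment> \<open>\<open>coinv_sym\<close> takes its degree from the length of the symbol;
      \<open>eval_nat_numeral\<close> matches that length with \<open>3\<close>.\<close>
    by (auto simp: W_def coinv_bar_def coinv_sym_eq eval_nat_numeral split: prod.splits
        intro!: arg_cong[where f = "\<lambda>f. finsum _ f _"])
  also have "\<dots> = bar.cls 3 (sum ?f {..<length w})"
    by (rule bar.tensor_class_finsum) (use closed in auto)
  finally show "W G w = bar.cls 3 (word_frag w)"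
    by (simp only: sum)
qed

abbreviation boundary_frag :: "(int \<times> 'a bar_chain \<Rightarrow>\<^sub>0 int) \<Rightarrow> (int \<times> 'a bar_chain \<Rightarrow>\<^sub>0 int)" where
  "boundary_frag \<equiv> frag_extend (\<lambda>(a, m). frag_of (a, bar_boundary G 3 m))"

lemma coinv_boundary_class: "coinv_boundary G 3 (bar.cls 3 z) = bar.cls 2 (boundary_frag z)"
  unfolding coinv_boundary_def
  using tensor_map_class[OF tensor_factors_bar tensor_factors_bar, of 3 "bar_boundary G 3" 2 z]
    bar_boundary_closed[of _ 3] bar_boundary_smult[of _ _ 3] bar_boundary_add
  by simp

text \<open>By \<open>frag_of_boundary\<close> each factor gives its symbol \<open>[x|y]\<close>
  minus the loop it spells, with exponent; the loops add up to the path sum of the value of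
  \<open>w\<close>.\<close>

lemma boundary_word_frag:
  assumes "list_all (factor_ok G) w"
  shows "boundary_frag (word_frag w)
    - (lift_syms (symbol_sum w) - lift_syms (path_sum G \<one> (word_value G w))) \<in> bar.ker 2"
  \<comment> \<open>Afterwards all three terms are sums over the entries of \<open>w\<close>, and
    induction on the list applies.\<close>
  unfolding path_sum_word_value[OF assms]
  using assms
proof (induction w)
  case Nil
  then show ?case
    by (simp add: word_frag_def lift_syms_simps bar.tensor_kernel_zero)
next
  case (Cons f w)
  obtain u x y n where f: "f = (u, x, y, n)" by (cases f)
  have ok: "eval_hom G u \<in> carrier G" "x \<in> carrier G" "y \<in> carrier G"
    using Cons.prems by (auto simp: f factor_ok_def eval_hom_closed)
  have "boundary_frag (word_frag (f # w))
      = frag_of (n, bar_boundary G 3 (bar_sym G [eval_hom G u, x, y])) + boundary_frag (word_frag w)"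
    by (simp add: word_frag_def f frag_extend_add)
  then show ?case
    using bar.tensor_kernel_add[OF frag_of_boundary[OF ok, of n] Cons.IH] Cons.prems
    by (simp add: f lift_syms_simps frag_cmul_distrib2 frag_cmul_minus_right algebra_simps
        del: minus_frag_cmul)
qed

text \<open>Connects the sums in the theorem with symbol sums: an explicit representative, its
  membership in the carrier, and its agreement modulo the kernel with a lifted combination of
  symbols, by \<open>frag_of_scale\<close>.\<close>

lemma sum_coinv_sym:
  assumes "finite I" "x \<in> I \<rightarrow> carrier G" "y \<in> I \<rightarrow> carrier G"
  shows "(\<Oplus>\<^bsub>coinv_bar G 2\<^esub>i\<in>I. coinv_sym G (n i) [x i, y i])
      = bar.cls 2 (\<Sum>i\<in>I. frag_of (n i, bar_sym G [x i, y i]))"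
    and "(\<Sum>i\<in>I. frag_of (n i, bar_sym G [x i, y i])) \<in> carrier (bar.frags 2)"
    and "(\<Sum>i\<in>I. frag_of (n i, bar_sym G [x i, y i]))
      - lift_syms (\<Sum>i\<in>I. frag_cmul (n i) (frag_of [x i, y i])) \<in> bar.ker 2"
proof -
  have closed: "frag_of (n i, bar_sym G [x i, y i]) \<in> carrier (bar.frags 2)" if "i \<in> I" for i
    using assms(2,3) that by (intro frag_of_bar_sym_closed) auto
  have "(\<Oplus>\<^bsub>coinv_bar G 2\<^esub>i\<in>I. coinv_sym G (n i) [x i, y i])
      = (\<Oplus>\<^bsub>bar.tens 2\<^esub>i\<in>I. bar.cls 2 (frag_of (n i, bar_sym G [x i, y i])))"
    by (simp add: coinv_bar_def coinv_sym_eq eval_nat_numeral)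
  also have "\<dots> = bar.cls 2 (\<Sum>i\<in>I. frag_of (n i, bar_sym G [x i, y i]))"
    by (rule bar.tensor_class_finsum[OF assms(1) closed])
  finally show "(\<Oplus>\<^bsub>coinv_bar G 2\<^esub>i\<in>I. coinv_sym G (n i) [x i, y i])
      = bar.cls 2 (\<Sum>i\<in>I. frag_of (n i, bar_sym G [x i, y i]))" .
  show "(\<Sum>i\<in>I. frag_of (n i, bar_sym G [x i, y i])) \<in> carrier (bar.frags 2)"
    using closed by (rule bar.frags_sum_closed)
  have "lift_syms (\<Sum>i\<in>I. frag_cmul (n i) (frag_of [x i, y i]))
      = (\<Sum>i\<in>I. frag_cmul (n i) (frag_of (1, bar_sym G [x i, y i])))"
    using assms(1) by (induction I rule: finite_induct) (simp_all add: lift_syms_simps)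
  moreover have "(\<Sum>i\<in>I. frag_of (n i, bar_sym G [x i, y i])
      - frag_cmul (n i) (frag_of (1, bar_sym G [x i, y i]))) \<in> bar.ker 2"
    using assms(2,3) by (intro bar.tensor_kernel_sum frag_of_scale bar_sym_closed) auto
  ultimately show "(\<Sum>i\<in>I. frag_of (n i, bar_sym G [x i, y i]))
      - lift_syms (\<Sum>i\<in>I. frag_cmul (n i) (frag_of [x i, y i])) \<in> bar.ker 2"
    by (simp add: sum_subtractf)
qed

text \<open>The path sums of the two products coincide because their values do, so they drop out of
  the difference and only symbol sums remain.\<close>

lemma boundary_W_diff:
  assumes w: "list_all (factor_ok G) w" "list_all (factor_ok G) w'"
    and val: "word_value G w = word_value G w'"
  shows "coinv_boundary G 3 (W G w \<ominus>\<^bsub>coinv_bar G 3\<^esub> W G w')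
    = bar.cls 2 (lift_syms (symbol_sum w) - lift_syms (symbol_sum w'))"
proof -
  have "coinv_boundary G 3 (W G w \<ominus>\<^bsub>coinv_bar G 3\<^esub> W G w')
      = bar.cls 2 (boundary_frag (word_frag w) - boundary_frag (word_frag w'))"
    unfolding coinv_bar_def W_eq(1)[OF w(1)] W_eq(1)[OF w(2)]
      bar.tensor_class_diff[OF W_eq(2)[OF w(1)] W_eq(2)[OF w(2)]]
      coinv_boundary_class frag_extend_diff ..
  also have "\<dots> = bar.cls 2 (lift_syms (symbol_sum w) - lift_syms (symbol_sum w'))"
    using bar.tensor_kernel_diff[OF boundary_word_frag[OF w(1)] boundary_word_frag[OF w(2)]]
    by (intro bar.tensor_class_eqI) (simp add: val algebra_simps)
  finally show ?thesis .
qed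

end

theorem theorem3p8:
  fixes G :: "('a, 'b) monoid_scheme"
    and k l :: nat
    and C C' :: "nat \<Rightarrow> 'a commutator list"
    and E E' :: "nat \<Rightarrow> 'a relator_expr list"
    and v v' :: "nat \<Rightarrow> 'a fword"
    and x y x' y' :: "nat \<Rightarrow> 'a"
    and n n' :: "nat \<Rightarrow> int"
  assumes "group G"
    and "\<And>i c. i \<in> {1..k + 1} \<Longrightarrow> c \<in> set (C i) \<Longrightarrow> commutator_ok G c"
    and "\<And>i c. i \<in> {1..l + 1} \<Longrightarrow> c \<in> set (C' i) \<Longrightarrow> commutator_ok G c"
    and "\<And>i. i \<in> {1..k + 1} \<Longrightarrow> expressions_of G (E i) (C i)"
    and "\<And>i. i \<in> {1..l + 1} \<Longrightarrow> expressions_of G (E' i) (C' i)"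
    and "\<And>i. i \<in> {1..k} \<Longrightarrow>
           x i \<in> carrier G \<and> y i \<in> carrier G \<and> v i \<in> carrier (free_group_on G)"
    and "\<And>i. i \<in> {1..l} \<Longrightarrow>
           x' i \<in> carrier G \<and> y' i \<in> carrier G \<and> v' i \<in> carrier (free_group_on G)"
    and "side_value G k C v x y n = side_value G l C' v' x' y' n'"
  shows "coinv_boundary G 3
           (W G (side_word G k C E v x y n) \<ominus>\<^bsub>coinv_bar G 3\<^esub> W G (side_word G l C' E' v' x' y' n'))
       = (\<Oplus>\<^bsub>coinv_bar G 2\<^esub>i\<in>{1..k}. coinv_sym G (n i) [x i, y i])
         \<ominus>\<^bsub>coinv_bar G 2\<^esub> (\<Oplus>\<^bsub>coinv_bar G 2\<^esub>i\<in>{1..l}. coinv_sym G (n' i) [x' i, y' i])"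
proof -
  interpret bar_group G
    using assms(1) by (simp add: bar_group_def)
  let ?w = "side_word G k C E v x y n" and ?w' = "side_word G l C' E' v' x' y' n'"
  have w: "list_all (factor_ok G) ?w" "word_value G ?w = side_value G k C v x y n"
    by (rule side_word_correct; use assms(2,4,6) in blast)+
  have w': "list_all (factor_ok G) ?w'" "word_value G ?w' = side_value G l C' v' x' y' n'"
    by (rule side_word_correct; use assms(3,5,7) in blast)+
  have "x \<in> {1..k} \<rightarrow> carrier G" "y \<in> {1..k} \<rightarrow> carrier G"
    "x' \<in> {1..l} \<rightarrow> carrier G" "y' \<in> {1..l} \<rightarrow> carrier G"
    using assms(6,7) by blast+
  note s = sum_coinv_sym[OF finite_atLeastAtMost this(1,2)]
    and s' = sum_coinv_sym[OF finite_atLeastAtMost this(3,4)]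
  have "coinv_boundary G 3 (W G ?w \<ominus>\<^bsub>coinv_bar G 3\<^esub> W G ?w')
      = bar.cls 2 (lift_syms (symbol_sum ?w) - lift_syms (symbol_sum ?w'))"
    by (rule boundary_W_diff[OF w(1) w'(1)]) (simp only: w(2) w'(2) assms(8))
  also have "\<dots> = bar.cls 2 ((\<Sum>i\<in>{1..k}. frag_of (n i, bar_sym G [x i, y i]))
      - (\<Sum>i\<in>{1..l}. frag_of (n' i, bar_sym G [x' i, y' i])))"
    \<comment> \<open>Here the commutators disappear. The primed relation comes first because the
      kernel element wanted is the lifted sums minus the representatives.\<close>
    unfolding symbol_sum_side_word
    using bar.tensor_kernel_diff[OF s'(3)[where n = n'] s(3)[where n = n]]
    by (intro bar.tensor_class_eqI) (simp add: algebra_simps)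
  also have "\<dots> = (\<Oplus>\<^bsub>coinv_bar G 2\<^esub>i\<in>{1..k}. coinv_sym G (n i) [x i, y i])
      \<ominus>\<^bsub>coinv_bar G 2\<^esub> (\<Oplus>\<^bsub>coinv_bar G 2\<^esub>i\<in>{1..l}. coinv_sym G (n' i) [x' i, y' i])"
    \<comment> \<open>\<open>coinv_bar\<close> stays folded until \<open>s(1)\<close> and
      \<open>s'(1)\<close>, whose left-hand sides contain it, have been applied.\<close>
    unfolding s(1) s'(1) unfolding coinv_bar_def
    using bar.tensor_class_diff[OF s(2) s'(2)] by (rule sym)
  finally show ?thesis .
qed

end
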